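(* Let $G$ be a graph on $n$ vertices that is $\{3K_1,\text{paraglider}\}$-free. Then $\omega(G)\ge (n-1)/3$, and $\omega(G)=(n-1)/3$ if and only if $G$ is isomorphic to the complement $\overline{H^*}$ of the graph $H^*$ described below.
   Context: $3K_1$ is the edgeless graph on 3 vertices. A paraglider is the graph obtained from a 4-cycle $C_4$ by adding a vertex adjacent to exactly three vertices of the $C_4$ (equivalently, the complement of the disjoint union $P_2\cup P_3$ of a path on 2 vertices and a path on 3 vertices). A graph is $\mathcal F$-free if it contains no member of $\mathcal F$ as an induced subgraph. $\omega(G)$ is the clique number. The graph $H^*$ has 16 vertices $v_1,\dots,v_5,a_1,\dots,a_5,b_1,\dots,b_5,z$ (indices modulo 5) and exactly the following edges, for each $i\in\{1,\dots,5\}$: $v_iv_{i+1}$; $a_iv_i$; $a_ia_{i+2}$; $b_iv_{i-1}$ and $b_iv_{i+1}$; $a_ib_{i-2}$ and $a_ib_{i+2}$; $zb_i$. (It is 5-regular and triangle-free.) *)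

theory Defs
  imports Complex_Main "Graph_Theory.Graph_Theory" "HOL-Library.Numeral_Type"
begin

text \<open>
  A finite simple graph is a \<^typ>\<open>'a pair_pre_digraph\<close> satisfying the predicate
  \<^term>\<open>pair_graph\<close>, i.e. a finite vertex set with an irreflexive symmetric set of arcs;
  an edge $uv$ is the pair of arcs $(u,v)$, $(v,u)$.
\<close>

definition graph_of :: "'a set \<Rightarrow> 'a rel \<Rightarrow> 'a pair_pre_digraph" where
  "graph_of V E = \<lparr> pverts = V, parcs = E \<union> E\<inverse> \<rparr>"

definition graph_iso :: "'a pair_pre_digraph \<Rightarrow> 'b pair_pre_digraph \<Rightarrow> bool" where
  "graph_iso G H \<longleftrightarrow> digraph_iso (with_proj G) (with_proj H)"

definition complement :: "'a pair_pre_digraph \<Rightarrow> 'a pair_pre_digraph" where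
  "complement G = \<lparr> pverts = pverts G,
     parcs = {(u, v). u \<in> pverts G \<and> v \<in> pverts G \<and> u \<noteq> v \<and> (u, v) \<notin> parcs G} \<rparr>"

definition graph_free :: "'b pair_pre_digraph set \<Rightarrow> 'a pair_pre_digraph \<Rightarrow> bool" where
  "graph_free F G \<longleftrightarrow>
     \<not> (\<exists>H\<in>F. \<exists>K. induced_subgraph (with_proj K) (with_proj G) \<and> graph_iso K H)"

definition clique :: "'a pair_pre_digraph \<Rightarrow> 'a set \<Rightarrow> bool" where
  "clique G S \<longleftrightarrow> S \<subseteq> pverts G \<and> (\<forall>u\<in>S. \<forall>v\<in>S. u \<noteq> v \<longrightarrow> (u, v) \<in> parcs G)"

text \<open>
  Meaningful for finite graphs; the empty set is a clique, so the graph without vertices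
  has clique number 0.
\<close>
definition clique_number :: "'a pair_pre_digraph \<Rightarrow> nat" where
  "clique_number G = Max (card ` {S. clique G S})"

definition three_K1 :: "nat pair_pre_digraph" where
  "three_K1 = graph_of {0, 1, 2} {}"

definition paraglider :: "nat pair_pre_digraph" where
  "paraglider = graph_of {0, 1, 2, 3, 4}
     ({(0, 1), (1, 2), (2, 3), (3, 0)} \<union> {(4, 0), (4, 1), (4, 2)})"

text \<open>
  The numeral type \<^typ>\<open>5\<close> is the ring of integers modulo 5, with the index 5 represented
  by 0; all index arithmetic below is therefore modulo 5.
\<close>
datatype hstar_vertex = hv "5" | ha "5" | hb "5" | hz

definition hstar :: "hstar_vertex pair_pre_digraph" where
  "hstar = graph_of UNIV (\<Union>i.
     {(hv i, hv (i + 1)),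
      (ha i, hv i),
      (ha i, ha (i + 2)),
      (hb i, hv (i - 1)), (hb i, hv (i + 1)),
      (ha i, hb (i - 2)), (ha i, hb (i + 2)),
      (hz, hb i)})"

end

theory Submission
  imports Defs
begin

text \<open>
  Pass to the complement: let $H$ be triangle-free without an induced $P_2\cup P_3$, let $\alpha$
  bound its independent sets, and suppose that $H$ has at least $3\alpha+1$ vertices. For an edge
  $uv$ put $A=N(u)\setminus v$ and $B=N(v)\setminus u$. The vertices adjacent to neither $u$ nor $v$
  induce a graph without $P_3$, that is a matching $M$ with some number $k$ of edges and a set $I$
  of isolated vertices. Every vertex of $A\cup B$ is adjacent to exactly one end of each edge of $M$,
  so it has a $k$-bit label. Adjacent $x\in A$, $y\in B$ have complementary labels, non-adjacent ones
  differ in at most one bit, and two vertices on the same side differ in at most two bits.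
  Counting independent sets gives $2\alpha\le|A|+|B|+k$, hence $k\ge2$, while for $k\ge4$ the labels
  would be constant on $A$ and on $B$, which is too restrictive for that bound.
  For $k=3$ the labels in $A$ have a fixed parity and those in $B$ the other one, at most
  $\alpha-4$ vertices share a label, and everything is forced: $I$ is empty, $\alpha=5$, every label of
  the right parity occurs exactly once, and $H$ is the graph $H^*$.
  It follows that every non-isolated vertex has degree $\alpha$. For $k=2$ the vertices of $A\cup B$ then
  fall into two parity classes, each of which is the full neighbourhood of a vertex of $I$; so
  $|A|+|B|=2\alpha$, contradicting $|A|,|B|\le\alpha-1$.
\<close>

section \<open>Isomorphisms and induced subgraphs\<close>

lemma graph_isoD:
  assumes "graph_iso G H"
  obtains f where "bij_betw f (pverts G) (pverts H)"
    and "\<And>u v. u \<in> pverts G \<Longrightarrow> v \<in> pverts G \<Longrightarrow> (f u, f v) \<in> parcs H \<longleftrightarrow> (u, v) \<in> parcs G"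
proof -
  from assms obtain h where iso: "pre_digraph.digraph_isomorphism (with_proj G) h"
    and app: "with_proj H = app_iso h (with_proj G)"
    unfolding graph_iso_def digraph_iso_def by blast
  let ?f = "iso_verts h"
  from app have ends: "iso_tail h = fst" "iso_head h = snd"
    and verts: "pverts H = ?f ` pverts G" and arcs: "parcs H = iso_arcs h ` parcs G"
    by (simp_all add: with_proj_def app_iso_def)
  from iso have wf: "wf_digraph (with_proj G)" and inj: "inj_on ?f (pverts G)"
    and arc: "\<And>a. a \<in> parcs G \<Longrightarrow> iso_arcs h a = (?f (fst a), ?f (snd a))"
    by (auto simp: pre_digraph.digraph_isomorphism_def ends prod_eq_iff)
  show thesis
  proof
    show "bij_betw ?f (pverts G) (pverts H)"
      using inj verts by (simp add: bij_betw_def)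
    fix u v assume uv: "u \<in> pverts G" "v \<in> pverts G"
    show "(?f u, ?f v) \<in> parcs H \<longleftrightarrow> (u, v) \<in> parcs G"
    proof
      assume "(?f u, ?f v) \<in> parcs H"
      then obtain a where a: "a \<in> parcs G" "?f u = ?f (fst a)" "?f v = ?f (snd a)"
        using arc by (auto simp: arcs)
      moreover have "fst a \<in> pverts G" "snd a \<in> pverts G"
        using wf_digraph.wellformed[OF wf, of a] a(1) by simp_all
      ultimately have "u = fst a" "v = snd a"
        using inj uv by (auto dest: inj_onD)
      with a(1) show "(u, v) \<in> parcs G" by simp
    next
      assume "(u, v) \<in> parcs G"
      then show "(?f u, ?f v) \<in> parcs H"
        using arc[of "(u, v)"] by (force simp: arcs image_iff)
    qed
  qed
qed

lemma graph_isoI: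
  assumes wfG: "pair_wf_digraph G" and wfH: "pair_wf_digraph H"
    and bij: "bij_betw f (pverts G) (pverts H)"
    and arcs: "\<And>u v. u \<in> pverts G \<Longrightarrow> v \<in> pverts G \<Longrightarrow> (f u, f v) \<in> parcs H \<longleftrightarrow> (u, v) \<in> parcs G"
  shows "graph_iso G H"
proof -
  let ?h = "\<lparr>iso_verts = f, iso_arcs = map_prod f f, iso_head = snd, iso_tail = fst\<rparr>"
  have sub: "parcs G \<subseteq> pverts G \<times> pverts G" "parcs H \<subseteq> pverts H \<times> pverts H"
    using pair_wf_digraph.in_arcsD1 pair_wf_digraph.in_arcsD2 wfG wfH by fast+
  have inj: "inj_on f (pverts G)" and im: "f ` pverts G = pverts H"
    using bij by (auto simp: bij_betw_def)
  have "inj_on (map_prod f f) (parcs G)"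
    using map_prod_inj_on[OF inj inj] sub(1) by (rule inj_on_subset)
  then have "pre_digraph.digraph_isomorphism (with_proj G) ?h"
    using inj wfG by (auto simp: pre_digraph.digraph_isomorphism_def wf_digraph_wp_iff)
  moreover have "parcs H = map_prod f f ` parcs G"
  proof
    show "parcs H \<subseteq> map_prod f f ` parcs G"
    proof
      fix e assume e: "e \<in> parcs H"
      with sub(2) have "e \<in> f ` pverts G \<times> f ` pverts G"
        by (auto simp: im)
      then obtain u v where "u \<in> pverts G" "v \<in> pverts G" "e = (f u, f v)"
        by blast
      with e arcs show "e \<in> map_prod f f ` parcs G" by force
    qed
    show "map_prod f f ` parcs G \<subseteq> parcs H"
      using arcs sub(1) by auto
  qed
  then have "with_proj H = app_iso ?h (with_proj G)"
    using im by (simp add: with_proj_def app_iso_def)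
  ultimately show ?thesis
    unfolding graph_iso_def digraph_iso_def by blast
qed

lemma graph_iso_sym: "pair_wf_digraph G \<Longrightarrow> graph_iso G H \<Longrightarrow> graph_iso H G"
  unfolding graph_iso_def using wf_digraph_wp_iff by (metis digraph_iso_swap)

text \<open>The image of \<open>f\<close> with all arcs of \<open>G\<close> inside it is an induced
  subgraph, and \<open>f\<close> is an isomorphism from \<open>H\<close> onto it.\<close>

lemma not_graph_free:
  fixes G :: "'a pair_pre_digraph" and H :: "'b pair_pre_digraph"
  assumes wfG: "pair_wf_digraph G" and "H \<in> F" and wfH: "pair_wf_digraph H"
    and inj: "inj_on f (pverts H)" and sub: "f ` pverts H \<subseteq> pverts G"
    and arcs: "\<And>u v. u \<in> pverts H \<Longrightarrow> v \<in> pverts H \<Longrightarrow> (f u, f v) \<in> parcs G \<longleftrightarrow> (u, v) \<in> parcs H"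
  shows "\<not> graph_free F G"
proof -
  let ?S = "f ` pverts H"
  define K where "K = \<lparr>pverts = ?S, parcs = parcs G \<inter> ?S \<times> ?S\<rparr>"
  have K: "pair_wf_digraph K"
    by unfold_locales (auto simp: K_def)
  have "induced_subgraph (with_proj K) (with_proj G)"
    using wfG K sub
    by (auto simp: induced_subgraph_def subgraph_def wf_digraph_wp_iff compatible_def K_def)
  moreover have "graph_iso H K"
    by (rule graph_isoI[OF wfH K, of f]) (auto simp: K_def bij_betw_def inj arcs)
  then have "graph_iso K H"
    by (rule graph_iso_sym[OF wfH])
  ultimately show ?thesis
    using \<open>H \<in> F\<close> by (auto simp: graph_free_def)
qed

lemma wf_graph_of: "E \<subseteq> V \<times> V \<Longrightarrow> pair_wf_digraph (graph_of V E)"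
  by unfold_locales (auto simp: graph_of_def)

lemma wf_complement: "pair_wf_digraph (complement G)"
  by unfold_locales (auto simp: complement_def)

section \<open>The graph $H^*$\<close>

lemma UNIV_5: "(UNIV :: 5 set) = {0, 1, 2, 3, 4}"
proof (rule sym, rule card_seteq)
  have "card {0, 1, 2, 3, 4 :: 5} = 5" by simp
  then show "card (UNIV :: 5 set) \<le> card {0, 1, 2, 3, 4 :: 5}" by simp
qed auto

lemma all_5: "(\<forall>i :: 5. P i) \<longleftrightarrow> P 0 \<and> P 1 \<and> P 2 \<and> P 3 \<and> P 4"
  using UNIV_5 by (metis (no_types, lifting) UNIV_I empty_iff insert_iff)

lemma mod_5: "(- 1 :: 5) = 4" "(- 2 :: 5) = 3" "(5 :: 5) = 0" "(6 :: 5) = 1"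
  by simp_all

lemma all_hstar_vertex:
  "(\<forall>x. P x) \<longleftrightarrow> (\<forall>i. P (hv i)) \<and> (\<forall>i. P (ha i)) \<and> (\<forall>i. P (hb i)) \<and> P hz"
  by (metis hstar_vertex.exhaust)

lemma UNIV_hstar_vertex:
  "UNIV = set [hv 0, hv 1, hv 2, hv 3, hv 4, ha 0, ha 1, ha 2, ha 3, ha 4,
    hb 0, hb 1, hb 2, hb 3, hb 4, hz]"
proof -
  have "\<forall>x. x \<in> set [hv 0, hv 1, hv 2, hv 3, hv 4, ha 0, ha 1, ha 2, ha 3, ha 4,
    hb 0, hb 1, hb 2, hb 3, hb 4, hz]"
    unfolding all_hstar_vertex all_5 by simp
  then show ?thesis by blast
qed

lemma card_hstar_vertex: "card (UNIV :: hstar_vertex set) = 16"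
  unfolding UNIV_hstar_vertex by (subst distinct_card) simp_all

lemma parcs_hstar:
  "(hv i, hv j) \<in> parcs hstar \<longleftrightarrow> j = i + 1 \<or> i = j + 1"
  "(hv i, ha j) \<in> parcs hstar \<longleftrightarrow> i = j"
  "(ha i, hv j) \<in> parcs hstar \<longleftrightarrow> i = j"
  "(hv i, hb j) \<in> parcs hstar \<longleftrightarrow> i = j - 1 \<or> i = j + 1"
  "(hb i, hv j) \<in> parcs hstar \<longleftrightarrow> j = i - 1 \<or> j = i + 1"
  "(ha i, ha j) \<in> parcs hstar \<longleftrightarrow> j = i + 2 \<or> i = j + 2"
  "(ha i, hb j) \<in> parcs hstar \<longleftrightarrow> j = i - 2 \<or> j = i + 2"
  "(hb i, ha j) \<in> parcs hstar \<longleftrightarrow> i = j - 2 \<or> i = j + 2"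
  "(hb i, hb j) \<notin> parcs hstar"
  "(hz, hb i) \<in> parcs hstar" "(hb i, hz) \<in> parcs hstar"
  "(hz, hv i) \<notin> parcs hstar" "(hv i, hz) \<notin> parcs hstar"
  "(hz, ha i) \<notin> parcs hstar" "(ha i, hz) \<notin> parcs hstar"
  "(hz, hz) \<notin> parcs hstar"
  by (auto simp: hstar_def graph_of_def)

text \<open>The truth values stand for membership of consecutive vertices of a 5-cycle in an
  independent set; the \<open>ha\<close> form such a cycle in the order 0, 2, 4, 1, 3.\<close>

lemma five_cycle_independent_le_2:
  fixes a b c d e :: bool
  assumes "\<not> (a \<and> b)" "\<not> (b \<and> c)" "\<not> (c \<and> d)" "\<not> (d \<and> e)" "\<not> (e \<and> a)"
  shows "of_bool a + of_bool b + of_bool c + of_bool d + of_bool e \<le> (2 :: nat)"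
  using assms by (cases a; cases b; cases c; cases d; cases e) simp_all

text \<open>The \<open>hv\<close> and the \<open>ha\<close> each induce a 5-cycle and contribute at
  most 2. If \<open>hz\<close> is in \<open>S\<close>, no \<open>hb\<close> is, giving 2 + 2 + 1;
  otherwise each \<open>hb i\<close> in \<open>S\<close> excludes two vertices of either cycle, and
  the 32 possible sets of \<open>hb\<close> are examined.\<close>

lemma hstar_independent_le_5:
  assumes indep: "\<forall>x\<in>S. \<forall>y\<in>S. (x, y) \<notin> parcs hstar"
  shows "card S \<le> 5"
proof -
  have "card S = (\<Sum>x\<in>UNIV. of_bool (x \<in> S))"
    using finite_subset[OF subset_UNIV, of S] card_hstar_vertex
    by (simp add: card_ge_0_finite)
  also have "\<dots> = sum_list (map (\<lambda>x. of_bool (x \<in> S)) [hv 0, hv 1, hv 2, hv 3, hv 4,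
      ha 0, ha 1, ha 2, ha 3, ha 4, hb 0, hb 1, hb 2, hb 3, hb 4, hz])"
    unfolding UNIV_hstar_vertex by (subst sum_list_distinct_conv_sum_set) simp_all
  finally have card: "card S = \<dots>" .
  have ne: "\<And>x y. (x, y) \<in> parcs hstar \<Longrightarrow> \<not> (x \<in> S \<and> y \<in> S)"
    using indep by blast
  have v: "of_bool (hv 0 \<in> S) + of_bool (hv 1 \<in> S) + of_bool (hv 2 \<in> S)
      + of_bool (hv 3 \<in> S) + of_bool (hv 4 \<in> S) \<le> (2 :: nat)"
    by (rule five_cycle_independent_le_2; rule ne; simp add: parcs_hstar)
  have a: "of_bool (ha 0 \<in> S) + of_bool (ha 2 \<in> S) + of_bool (ha 4 \<in> S)
      + of_bool (ha 1 \<in> S) + of_bool (ha 3 \<in> S) \<le> (2 :: nat)"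
    by (rule five_cycle_independent_le_2; rule ne; simp add: parcs_hstar)
  have bv: "hv (i - 1) \<notin> S \<and> hv (i + 1) \<notin> S" if "hb i \<in> S" for i
    using ne[of "hb i" "hv (i - 1)"] ne[of "hb i" "hv (i + 1)"] that by (simp add: parcs_hstar)
  have ba: "ha (i - 2) \<notin> S \<and> ha (i + 2) \<notin> S" if "hb i \<in> S" for i
    using ne[of "hb i" "ha (i - 2)"] ne[of "hb i" "ha (i + 2)"] that by (simp add: parcs_hstar)
  show ?thesis
  proof (cases "hz \<in> S")
    case True
    then have "hb i \<notin> S" for i
      using ne[of hz "hb i"] by (simp add: parcs_hstar)
    then show ?thesis
      using v a True by (simp add: card)
  next
    case False
    note bva = bv[of 0] bv[of 1] bv[of 2] bv[of 3] bv[of 4] ba[of 0] ba[of 1] ba[of 2] ba[of 3] ba[of 4]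
    note b = bva[simplified, unfolded mod_5, simplified]
    show ?thesis
      using v a b False unfolding card
      by (cases "hb 0 \<in> S"; cases "hb 1 \<in> S"; cases "hb 2 \<in> S"; cases "hb 3 \<in> S"; cases "hb 4 \<in> S") simp_all
  qed
qed

section \<open>The neighbourhood of an edge\<close>

text \<open>
  \<open>E\<close> is the adjacency of the complement of the graph in the theorem, \<open>\<alpha>\<close> its clique number.
\<close>
locale extremal_graph =
  fixes V :: "'a set" and E :: "'a \<Rightarrow> 'a \<Rightarrow> bool" and \<alpha> :: nat
  assumes finite_V: "finite V"
    and E_V: "E x y \<Longrightarrow> x \<in> V"
    and E_sym: "E x y \<Longrightarrow> E y x"
    and triangle: "E x y \<Longrightarrow> E y z \<Longrightarrow> \<not> E x z"
    and p2p3: "E a b \<Longrightarrow> E c d \<Longrightarrow> E d e \<Longrightarrow> c \<noteq> e \<Longrightarrow>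
      E a c \<or> E a d \<or> E a e \<or> E b c \<or> E b d \<or> E b e"
    and indep: "S \<subseteq> V \<Longrightarrow> (\<And>x y. x \<in> S \<Longrightarrow> y \<in> S \<Longrightarrow> \<not> E x y) \<Longrightarrow> card S \<le> \<alpha>"
    and large: "3 * \<alpha> + 1 \<le> card V"
begin

lemma E_commute: "E x y \<longleftrightarrow> E y x"
  using E_sym by blast

lemma E_V2: "E x y \<Longrightarrow> y \<in> V"
  using E_sym E_V by blast

lemma irrefl: "\<not> E x x"
  using triangle by blast

definition nbr :: "'a \<Rightarrow> 'a set" where
  "nbr x = {y. E x y}"

definition rest :: "'a \<Rightarrow> 'a \<Rightarrow> 'a set" where
  "rest u v = {r \<in> V. \<not> E u r \<and> \<not> E v r}"

text \<open>The vertices covered by the matching that \<open>rest u v\<close> induces when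
  \<open>u\<close> and \<open>v\<close> are adjacent; uniqueness of the partner is
  \<open>matched_unique\<close>.\<close>

definition matched :: "'a \<Rightarrow> 'a \<Rightarrow> 'a set" where
  "matched u v = {m \<in> rest u v. \<exists>n \<in> rest u v. E m n}"

lemma nbr_iff: "y \<in> nbr x \<longleftrightarrow> E x y"
  by (simp add: nbr_def)

lemma nbr_V: "nbr x \<subseteq> V"
  using E_V2 by (auto simp: nbr_def)

lemma finite_nbr: "finite (nbr x)"
  using nbr_V finite_V by (rule finite_subset)

lemma rest_commute: "rest u v = rest v u"
  by (auto simp: rest_def)

lemma matched_commute: "matched u v = matched v u"
  by (simp add: matched_def rest_commute)

text \<open>A path \<open>n m n'\<close> inside \<open>rest u v\<close> and the edge
  \<open>u v\<close> would form an induced P_2 \<union> P_3.\<close>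

lemma matched_unique:
  assumes "E u v" "m \<in> rest u v" "n \<in> rest u v" "n' \<in> rest u v" "E m n" "E m n'"
  shows "n = n'"
  using p2p3[of u v n m n'] assms by (auto simp: rest_def E_commute)

text \<open>An injective numbering of the vertices breaks the symmetry: \<open>T\<close> takes the
  end with the smaller number of each matching edge.\<close>

lemma exists_transversal:
  assumes uv: "E u v"
  obtains T where "T \<subseteq> matched u v"
    and "\<And>m n. m \<in> matched u v \<Longrightarrow> n \<in> matched u v \<Longrightarrow> E m n \<Longrightarrow> m \<in> T \<longleftrightarrow> n \<notin> T"
proof -
  obtain f :: "'a \<Rightarrow> nat" where f: "inj_on f V"
    using finite_imp_inj_to_nat_seg[OF finite_V] by blast
  define T where "T = {m \<in> matched u v. \<forall>n \<in> matched u v. E m n \<longrightarrow> f m < f n}"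
  have pair: "m \<in> T \<longleftrightarrow> n \<notin> T" if mn: "m \<in> matched u v" "n \<in> matched u v" "E m n" for m n
  proof -
    have T_iff: "m \<in> T \<longleftrightarrow> f m < f n" if "m \<in> matched u v" "n \<in> matched u v" "E m n" for m n
      using matched_unique[OF uv, of m n] that by (auto simp: T_def matched_def)
    have "f m \<noteq> f n"
      using mn f irrefl by (auto simp: matched_def rest_def dest: inj_onD)
    then show ?thesis
      using T_iff[of m n] T_iff[of n m] mn E_sym by auto
  qed
  have "T \<subseteq> matched u v"
    unfolding T_def by blast
  then show thesis
    using pair by (rule that)
qed

end

text \<open>
  \<open>T\<close> contains one end of every matching edge, so the label of a vertex \<open>z\<close> is the trace of its
  neighbourhood on \<open>T\<close>.
\<close>
locale extremal_edge = extremal_graph +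
  fixes u v :: 'a and T :: "'a set"
  assumes uv: "E u v"
    and T_sub: "T \<subseteq> matched u v"
    and T_pair: "m \<in> matched u v \<Longrightarrow> n \<in> matched u v \<Longrightarrow> E m n \<Longrightarrow> m \<in> T \<longleftrightarrow> n \<notin> T"
begin

abbreviation A :: "'a set" where "A \<equiv> nbr u - {v}"
abbreviation B :: "'a set" where "B \<equiv> nbr v - {u}"
abbreviation M :: "'a set" where "M \<equiv> matched u v"
abbreviation I :: "'a set" where "I \<equiv> rest u v - matched u v"

text \<open>Transfers results about \<open>A\<close> to \<open>B\<close>; \<open>T\<close> can be
  kept, since \<open>matched\<close> is symmetric in its arguments.\<close>

lemma swap: "extremal_edge V E \<alpha> v u T"
  using E_sym[OF uv] T_sub T_pair
  by unfold_locales (unfold matched_commute[of v u], blast+)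

lemma M_rest: "M \<subseteq> rest u v"
  by (auto simp: matched_def)

lemma rest_V: "rest u v \<subseteq> V"
  by (auto simp: rest_def)

lemma finite_rest: "finite (rest u v)"
  using rest_V finite_V by (rule finite_subset)

lemma finite_M: "finite M"
  using M_rest finite_rest by (rule finite_subset)

lemma finite_T: "finite T"
  using T_sub finite_M by (rule finite_subset)

lemma uv_rest: "r \<in> rest u v \<Longrightarrow> \<not> E u r \<and> \<not> E r u \<and> \<not> E v r \<and> \<not> E r v \<and> r \<noteq> u \<and> r \<noteq> v"
  using uv unfolding rest_def by (blast dest: E_sym)

lemma I_isolated: "w \<in> I \<Longrightarrow> r \<in> rest u v \<Longrightarrow> \<not> E w r \<and> \<not> E r w"
  unfolding matched_def by (blast dest: E_sym)

lemma A_indep: "x \<in> A \<Longrightarrow> y \<in> A \<Longrightarrow> \<not> E x y"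
  and B_indep: "x \<in> B \<Longrightarrow> y \<in> B \<Longrightarrow> \<not> E x y"
  unfolding nbr_def by (blast dest: triangle E_sym)+

lemma A_uv: "x \<in> A \<Longrightarrow> E u x \<and> E x u \<and> \<not> E v x \<and> \<not> E x v \<and> x \<noteq> u \<and> x \<noteq> v \<and> x \<notin> rest u v"
  using uv irrefl unfolding nbr_def rest_def by (blast dest: triangle E_sym)

lemma B_uv: "x \<in> B \<Longrightarrow> E v x \<and> E x v \<and> \<not> E u x \<and> \<not> E x u \<and> x \<noteq> u \<and> x \<noteq> v \<and> x \<notin> rest u v"
  using uv irrefl unfolding nbr_def rest_def by (blast dest: triangle E_sym)

section \<open>The matching and the labels it induces on \<open>A\<close> and
  \<open>B\<close>\<close>

lemma partner:
  assumes "m \<in> M"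
  obtains n where "n \<in> M" "E m n" "E n m"
  using assms E_sym unfolding matched_def by blast

lemma partner_unique: "m \<in> M \<Longrightarrow> n \<in> M \<Longrightarrow> n' \<in> M \<Longrightarrow> E m n \<Longrightarrow> E m n' \<Longrightarrow> n = n'"
  using matched_unique[OF uv] M_rest by blast

text \<open>The map to the matching partner is an involution that exchanges \<open>X\<close> and
  \<open>M - X\<close>.\<close>

lemma card_transversal:
  assumes sub: "X \<subseteq> M"
    and pair: "\<And>m n. m \<in> M \<Longrightarrow> n \<in> M \<Longrightarrow> E m n \<Longrightarrow> m \<in> X \<longleftrightarrow> n \<notin> X"
  shows "card M = 2 * card X"
proof -
  define g where "g m = (SOME n. n \<in> M \<and> E m n)" for m
  have g: "g m \<in> M" "E m (g m)" if "m \<in> M" for m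
    using someI_ex[of "\<lambda>n. n \<in> M \<and> E m n"] partner[OF that] unfolding g_def by blast+
  have gX: "m \<in> X \<longleftrightarrow> g m \<notin> X" if "m \<in> M" for m
    using pair g that by blast
  have gg: "g (g m) = m" if "m \<in> M" for m
    using that g[of "g m"] g[OF that] partner_unique E_sym by blast
  have "bij_betw g X (M - X)"
  proof (rule bij_betwI[where g = g])
    show "g \<in> X \<rightarrow> M - X" "g \<in> M - X \<rightarrow> X"
      using g(1) gX sub by blast+
    show "g (g m) = m" if "m \<in> X" for m
      using gg that sub by blast
    show "g (g m) = m" if "m \<in> M - X" for m
      using gg that by blast
  qed
  then have "card X = card (M - X)"
    by (rule bij_betw_same_card)
  moreover have "card M = card X + card (M - X)"
    using sub finite_M by (metis card_Diff_subset card_mono finite_subset le_add_diff_inverse)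
  ultimately show ?thesis by simp
qed

lemma card_M: "card M = 2 * card T"
  using card_transversal T_sub T_pair by blast

text \<open>If \<open>z\<close> missed both ends, the edge \<open>m n\<close> and the path
  \<open>v u z\<close> or \<open>u v z\<close> would be an induced P_2 \<union> P_3; seeing both
  would close a triangle.\<close>

lemma exactly_one:
  assumes "z \<in> A \<union> B" "m \<in> M" "n \<in> M" "E m n"
  shows "E z m \<longleftrightarrow> \<not> E z n"
proof -
  have "E z m \<or> E z n"
    using assms p2p3[of m n v u z] p2p3[of m n u v z] uv uv_rest M_rest E_sym A_uv B_uv
    by (metis UnE subsetD)
  then show ?thesis
    using triangle[of z m n] assms by blast
qed

lemma transversal_nbr: "z \<in> A \<union> B \<Longrightarrow> card {m \<in> M. E z m} = card T"
  and transversal_not_nbr: "z \<in> A \<union> B \<Longrightarrow> card {m \<in> M. \<not> E z m} = card T"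
  using card_transversal[of "{m \<in> M. E z m}"] card_transversal[of "{m \<in> M. \<not> E z m}"]
    card_M exactly_one by auto

text \<open>If \<open>z\<close> and \<open>z'\<close> disagree at \<open>m\<close>, they disagree
  the other way round at its partner, so \<open>p\<close> can be taken as the end that only
  \<open>z\<close> sees.\<close>

lemma orient:
  assumes "z \<in> A \<union> B" "z' \<in> A \<union> B" "m \<in> M" "E z m \<noteq> E z' m"
  obtains p where "p \<in> M" "p = m \<or> E m p" "E z p" "\<not> E z' p"
  using assms exactly_one partner[of m] by metis

text \<open>\<open>m\<close> and \<open>m'\<close> lie on different matching edges, and replacing
  either by its partner does not change this.\<close>

lemma pairs_disjoint:
  assumes "m \<in> M" "m' \<in> M" "m \<noteq> m'" "\<not> E m m'"
    and "p \<in> M" "p' \<in> M" "p = m \<or> E m p" "p' = m' \<or> E m' p'"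
  shows "p \<noteq> p' \<and> \<not> E p p' \<and> \<not> E p' p"
  using assms partner_unique E_sym by metis

text \<open>Adjacent vertices have no common neighbour. Applied to the partner of \<open>m\<close>,
  this also excludes that both miss \<open>m\<close>.\<close>

lemma adjacent_complementary:
  assumes "x \<in> A \<union> B" "y \<in> A \<union> B" "E x y" "m \<in> M"
  shows "E x m \<longleftrightarrow> \<not> E y m"
proof -
  obtain n where "n \<in> M" "E m n" using partner assms by metis
  then show ?thesis
    using exactly_one[of x m n] exactly_one[of y m n] assms triangle by blast
qed

text \<open>With two differing bits, the edge \<open>x p\<close> and the path \<open>v y r\<close>
  would be an induced P_2 \<union> P_3.\<close>

lemma opposite_near:
  assumes x: "x \<in> A" and y: "y \<in> B" and "\<not> E x y"
    and m: "m \<in> M" "m' \<in> M" "m \<noteq> m'" "\<not> E m m'" "E x m \<noteq> E y m"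
  shows "E x m' = E y m'"
proof (rule ccontr)
  assume "E x m' \<noteq> E y m'"
  obtain p where p: "p \<in> M" "p = m \<or> E m p" "E x p" "\<not> E y p"
    using orient[of x y m] x y m by blast
  obtain r where r: "r \<in> M" "r = m' \<or> E m' r" "E y r" "\<not> E x r"
    using orient[of y x m'] x y m \<open>E x m' \<noteq> E y m'\<close> by blast
  have "\<not> E p r" using pairs_disjoint m p r by blast
  then show False
    using p2p3[of x p v y r] p r uv_rest M_rest A_uv[OF x] B_uv[OF y] \<open>\<not> E x y\<close> E_sym
    by blast
qed

text \<open>With three differing bits, the edge \<open>z p\<close> and the path
  \<open>q z' r\<close> would be an induced P_2 \<union> P_3.\<close>

lemma nonadjacent_near:
  assumes z: "z \<in> A \<union> B" "z' \<in> A \<union> B" "\<not> E z z'"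
    and m: "m \<in> M" "m' \<in> M" "m'' \<in> M" "m \<noteq> m'" "m \<noteq> m''" "m' \<noteq> m''"
      "\<not> E m m'" "\<not> E m m''" "\<not> E m' m''" "E z m \<noteq> E z' m" "E z m' \<noteq> E z' m'"
  shows "E z m'' = E z' m''"
proof (rule ccontr)
  assume m'': "E z m'' \<noteq> E z' m''"
  obtain p where p: "p \<in> M" "p = m \<or> E m p" "E z p" "\<not> E z' p"
    using orient[of z z' m] z m by blast
  obtain q where q: "q \<in> M" "q = m' \<or> E m' q" "E z' q" "\<not> E z q"
    using orient[of z' z m'] z m by metis
  obtain r where r: "r \<in> M" "r = m'' \<or> E m'' r" "E z' r" "\<not> E z r"
    using orient[of z' z m''] z m m'' by metis
  have "\<not> E p q" "\<not> E p r" "q \<noteq> r" using pairs_disjoint m p q r by metis+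
  then show False
    using p2p3[of z p q z' r] p q r z(3) E_sym by blast
qed

text \<open>If \<open>w\<close> saw only \<open>z'\<close>, the edge \<open>z p\<close> and the path
  \<open>w z' q\<close> would be an induced P_2 \<union> P_3; the case that it sees only
  \<open>z\<close> is symmetric.\<close>

lemma isolated_same_side:
  assumes z: "z \<in> A \<union> B" "z' \<in> A \<union> B" "\<not> E z z'" and w: "w \<in> I"
    and m: "m \<in> M" "m' \<in> M" "m \<noteq> m'" "\<not> E m m'" "E z m \<noteq> E z' m" "E z m' \<noteq> E z' m'"
  shows "E w z \<longleftrightarrow> E w z'"
proof -
  have "E w z" if z: "z \<in> A \<union> B" "z' \<in> A \<union> B" "\<not> E z z'"
    and m: "E z m \<noteq> E z' m" "E z m' \<noteq> E z' m'" and "E w z'" for z z'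
  proof (rule ccontr)
    assume "\<not> E w z"
    obtain p where p: "p \<in> M" "p = m \<or> E m p" "E z p" "\<not> E z' p"
      using orient[of z z' m] z m \<open>m \<in> M\<close> by blast
    obtain q where q: "q \<in> M" "q = m' \<or> E m' q" "E z' q" "\<not> E z q"
      using orient[of z' z m'] z m \<open>m' \<in> M\<close> by metis
    have "\<not> E p q" using pairs_disjoint assms p q by metis
    moreover have "\<not> E w p" "\<not> E w q" "w \<noteq> q"
      using I_isolated w p q M_rest by blast+
    ultimately show False
      using p2p3[of z p w z' q] p q z(3) \<open>E w z'\<close> \<open>\<not> E w z\<close> E_sym by blast
  qed
  from this[of z z'] this[of z' z] show ?thesis
    using assms E_sym by blast
qed

text \<open>Here a single differing bit suffices, because \<open>u\<close> and \<open>v\<close>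
  supply the remaining end of the path: the forbidden pairs are \<open>x w\<close> with
  \<open>v y q\<close>, and \<open>y w\<close> with \<open>u x p\<close>.\<close>

lemma isolated_opposite_side:
  assumes x: "x \<in> A" and y: "y \<in> B" and "\<not> E x y" and w: "w \<in> I"
    and m: "m \<in> M" "E x m \<noteq> E y m"
  shows "E w x \<longleftrightarrow> E w y"
proof -
  obtain p where p: "p \<in> M" "E x p" "\<not> E y p"
    using orient[of x y m] x y m by blast
  obtain q where q: "q \<in> M" "E y q" "\<not> E x q"
    using orient[of y x m] x y m by blast
  have "\<not> E w p" "\<not> E w q" "\<not> E w u" "\<not> E w v"
    using I_isolated w p q M_rest uv_rest by blast+
  then show ?thesis
    using p2p3[of x w v y q] p2p3[of y w u x p] p q A_uv[OF x] B_uv[OF y] \<open>\<not> E x y\<close> E_sym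
      uv_rest M_rest by blast
qed

lemma T_M: "m \<in> T \<Longrightarrow> m \<in> M"
  using T_sub by blast

lemma T_indep: "m \<in> T \<Longrightarrow> n \<in> T \<Longrightarrow> \<not> E m n"
  using T_pair T_M by blast

text \<open>A bit outside \<open>T\<close> is the negation of the bit at the partner, which lies in
  \<open>T\<close>.\<close>

lemma bits_M:
  assumes z: "z \<in> A \<union> B" "z' \<in> A \<union> B" and T: "\<And>m. m \<in> T \<Longrightarrow> E z m \<longleftrightarrow> E z' m" and m: "m \<in> M"
  shows "E z m \<longleftrightarrow> E z' m"
proof (cases "m \<in> T")
  case False
  obtain n where n: "n \<in> M" "E m n" using partner m by metis
  then have "n \<in> T" using T_pair m False by blast
  then show ?thesis using T exactly_one n z m by metis
qed (rule T)

section \<open>Counting with independent sets\<close>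

lemma card_V: "card V = 2 + card A + card B + 2 * card T + card I"
proof -
  have fin: "finite A" "finite B" "finite M" "finite I"
    using finite_nbr finite_M finite_rest by auto
  have "V = {u, v} \<union> A \<union> B \<union> M \<union> I"
    using uv E_V E_V2 by (auto simp: nbr_iff rest_def matched_def)
  then have "card V = card ({u, v} \<union> A \<union> B \<union> M \<union> I)"
    by (rule arg_cong)
  also have "\<dots> = card ({u, v} \<union> A \<union> B \<union> M) + card I"
    by (rule card_Un_disjoint) (use fin in simp, use fin in simp, use A_uv B_uv uv_rest M_rest in blast)
  also have "card ({u, v} \<union> A \<union> B \<union> M) = card ({u, v} \<union> A \<union> B) + card M"
    by (rule card_Un_disjoint) (use fin in simp, use fin in simp, use A_uv B_uv uv_rest M_rest in blast)
  also have "card ({u, v} \<union> A \<union> B) = card ({u, v} \<union> A) + card B"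
    by (rule card_Un_disjoint) (use fin in simp, use fin in simp, use A_uv B_uv in blast)
  also have "card ({u, v} \<union> A) = card {u, v} + card A"
    by (rule card_Un_disjoint) (simp, use fin in simp, use A_uv in blast)
  also have "card {u, v} = 2"
    using uv irrefl by (metis card_2_iff)
  finally show ?thesis
    by (simp only: card_M)
qed

lemma card_A: "card A + 1 = card (nbr u)"
  using card_Suc_Diff1[OF finite_nbr, of v u] uv by (simp add: nbr_iff)

text \<open>The independent set is the whole neighbourhood of \<open>u\<close>, that is
  \<open>A\<close> together with \<open>v\<close>.\<close>

lemma card_A_le: "card A + 1 \<le> \<alpha>"
  unfolding card_A by (intro indep nbr_V, unfold nbr_def) (blast dest: triangle E_sym)

lemma card_B_le: "card B + 1 \<le> \<alpha>"
  using extremal_edge.card_A_le[OF swap] .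

text \<open>The independent set consists of \<open>u\<close>, one end of each matching edge, and
  \<open>I\<close>.\<close>

lemma card_I_le: "card T + card I + 1 \<le> \<alpha>"
proof -
  have "card ({u} \<union> T \<union> I) \<le> \<alpha>"
  proof (rule indep)
    show "{u} \<union> T \<union> I \<subseteq> V" using uv E_V T_sub M_rest rest_V by blast
    show "\<not> E x y" if "x \<in> {u} \<union> T \<union> I" "y \<in> {u} \<union> T \<union> I" for x y
      using that irrefl T_indep T_M M_rest uv_rest I_isolated by blast
  qed
  moreover have "({u} \<union> T) \<inter> I = {}" "{u} \<inter> T = {}"
    using T_M M_rest uv_rest by blast+
  ultimately show ?thesis
    using finite_T finite_rest by (simp add: card_Un_disjoint)
qed

text \<open>The bound on \<open>card T + card I\<close> is inserted into the count of
  \<open>V\<close>; one of the two copies of \<open>card T\<close> survives.\<close>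

lemma card_sides: "2 * \<alpha> \<le> card A + card B + card T"
  using card_V card_I_le large by linarith

lemma card_T_ge_2: "2 \<le> card T"
  using card_sides card_A_le card_B_le by linarith

text \<open>Otherwise \<open>A \<union> B\<close> is independent, so \<open>card_sides\<close> gives
  \<alpha> \<le> \<open>card T\<close>, against \<open>card_I_le\<close>.\<close>

lemma exists_adjacent: obtains x y where "x \<in> A" "y \<in> B" "E x y"
proof -
  have "\<exists>x\<in>A. \<exists>y\<in>B. E x y"
  proof (rule ccontr)
    assume no: "\<not> ?thesis"
    have "card (A \<union> B) \<le> \<alpha>"
      using no A_indep B_indep E_sym nbr_V by (intro indep) blast+
    moreover have "A \<inter> B = {}" using A_uv B_uv by blast
    ultimately have "card A + card B \<le> \<alpha>"
      using finite_nbr by (simp add: card_Un_disjoint)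
    then show False using card_sides card_I_le by linarith
  qed
  then show thesis using that by blast
qed

text \<open>All members of \<open>C\<close> share the label of \<open>x\<close>, so they miss the
  same \<open>card T\<close> ends of matching edges. These ends together with \<open>v\<close>,
  \<open>C\<close> and \<open>J\<close> are independent.\<close>

lemma class_bound:
  assumes x: "x \<in> C" and C: "C \<subseteq> A"
    and bits: "\<And>x' m. x' \<in> C \<Longrightarrow> m \<in> T \<Longrightarrow> E x' m \<longleftrightarrow> E x m"
    and J: "J \<subseteq> I" "\<And>x' w. x' \<in> C \<Longrightarrow> w \<in> J \<Longrightarrow> \<not> E x' w"
  shows "card C + card T + card J + 1 \<le> \<alpha>"
proof -
  let ?N = "{m \<in> M. \<not> E x m}"
  have xA: "x \<in> A \<union> B" using x C by blast
  have bits_M: "\<not> E x' m" if "x' \<in> C" "m \<in> ?N" for x' m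
    using bits_M[of x' x m] bits that x C by blast
  have N: "\<not> E m n" if "m \<in> ?N" "n \<in> ?N" for m n
    using exactly_one[OF xA, of m n] that by blast
  have "card ({v} \<union> C \<union> ?N \<union> J) \<le> \<alpha>"
  proof (rule indep)
    show "{v} \<union> C \<union> ?N \<union> J \<subseteq> V"
      using uv E_V2 C J nbr_V M_rest rest_V by blast
    have vC: "\<not> E v y" if "y \<in> C \<union> ?N \<union> J" for y
      using that C J M_rest uv_rest A_uv by blast
    have CC: "\<not> E y z" if "y \<in> C" "z \<in> C \<union> ?N \<union> J" for y z
      using that bits_M A_indep C J by blast
    have NN: "\<not> E y z" if "y \<in> ?N \<union> J" "z \<in> ?N \<union> J" for y z
      using that N I_isolated J M_rest by blast
    show "\<not> E y z" if "y \<in> {v} \<union> C \<union> ?N \<union> J" "z \<in> {v} \<union> C \<union> ?N \<union> J" for y z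
      using that vC CC NN irrefl E_sym by blast
  qed
  moreover have "({v} \<union> C \<union> ?N) \<inter> J = {}" "({v} \<union> C) \<inter> ?N = {}" "{v} \<inter> C = {}"
    using C J M_rest uv_rest A_uv by blast+
  moreover have "finite C" "finite J"
    using C J finite_nbr finite_rest by (meson finite_Diff finite_subset)+
  ultimately show ?thesis
    using finite_M transversal_not_nbr[OF xA] by (simp add: card_Un_disjoint)
qed

lemma class_bound_B:
  assumes "y \<in> C" "C \<subseteq> B" "\<And>y' m. y' \<in> C \<Longrightarrow> m \<in> T \<Longrightarrow> E y' m \<longleftrightarrow> E y m"
    and "J \<subseteq> I" "\<And>y' w. y' \<in> C \<Longrightarrow> w \<in> J \<Longrightarrow> \<not> E y' w"
  shows "card C + card T + card J + 1 \<le> \<alpha>"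
  using extremal_edge.class_bound[OF swap, of y C J] assms
  unfolding matched_commute[of v u] rest_commute[of v u] by blast

section \<open>At most three matching edges\<close>

lemma opposite_diff:
  assumes "x \<in> A" "y \<in> B" "\<not> E x y"
  shows "card {m \<in> T. E x m \<noteq> E y m} \<le> 1"
proof -
  have eq: "m = m'" if "m \<in> T" "E x m \<noteq> E y m" "m' \<in> T" "E x m' \<noteq> E y m'" for m m'
    using opposite_near[OF assms, of m m'] that T_M T_indep by blast
  have "finite {m \<in> T. E x m \<noteq> E y m}"
    using finite_T by simp
  from card_le_Suc0_iff_eq[OF this] show ?thesis
    unfolding One_nat_def using eq by blast
qed

lemma same_diff:
  assumes "z \<in> A \<union> B" "z' \<in> A \<union> B" "\<not> E z z'"
  shows "card {m \<in> T. E z m \<noteq> E z' m} \<le> 2"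
proof (rule ccontr)
  assume "\<not> ?thesis"
  then have "3 \<le> card {m \<in> T. E z m \<noteq> E z' m}"
    by simp
  then obtain X where X: "X \<subseteq> {m \<in> T. E z m \<noteq> E z' m}" "card X = 3"
    by (rule obtain_subset_with_card_n)
  from X(2) obtain a b c where "X = {a, b, c}" "a \<noteq> b" "a \<noteq> c" "b \<noteq> c"
    unfolding card_3_iff by blast
  then show False
    using nonadjacent_near[OF assms, of a b c] T_M T_indep X(1) by blast
qed

text \<open>The labels of \<open>x0\<close> and \<open>y0\<close> are complementary, so at each bit
  \<open>x\<close> differs from one of them. Without the edge \<open>x y0\<close> this accounts for
  at most 2 + 1 bits.\<close>

lemma all_adjacent:
  assumes T4: "4 \<le> card T" and x0: "x0 \<in> A" "y0 \<in> B" "E x0 y0" and x: "x \<in> A"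
  shows "E x y0"
proof (rule ccontr)
  assume "\<not> E x y0"
  have "T \<subseteq> {m \<in> T. E x m \<noteq> E y0 m} \<union> {m \<in> T. E x m \<noteq> E x0 m}"
    using adjacent_complementary[of x0 y0] x0 T_M by blast
  then have "card T \<le> card ({m \<in> T. E x m \<noteq> E y0 m} \<union> {m \<in> T. E x m \<noteq> E x0 m})"
    using finite_T by (intro card_mono) simp_all
  also have "\<dots> \<le> card {m \<in> T. E x m \<noteq> E y0 m} + card {m \<in> T. E x m \<noteq> E x0 m}"
    by (rule card_Un_le)
  also have "card {m \<in> T. E x m \<noteq> E y0 m} \<le> 1"
    by (rule opposite_diff[OF x x0(2) \<open>\<not> E x y0\<close>])
  also have "card {m \<in> T. E x m \<noteq> E x0 m} \<le> 2"
    using x x0(1) A_indep by (intro same_diff) blast+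
  finally show False
    using T4 by simp
qed

text \<open>By \<open>all_adjacent\<close> the labels are constant on \<open>A\<close> and on
  \<open>B\<close>. The class bounds for all of \<open>A\<close> and all of \<open>B\<close> add up
  to \<open>card A + card B + 2 * card T + 2\<close> \<le> 2\<alpha>, against
  \<open>card_sides\<close>.\<close>

lemma card_T_le_3: "card T \<le> 3"
proof (rule ccontr)
  assume "\<not> ?thesis"
  then have T4: "4 \<le> card T" by simp
  obtain x0 y0 where xy: "x0 \<in> A" "y0 \<in> B" "E x0 y0"
    by (rule exists_adjacent)
  have bits_A: "E x m \<longleftrightarrow> E x0 m" if "x \<in> A" "m \<in> T" for x m
    using adjacent_complementary[of x y0 m] adjacent_complementary[of x0 y0 m]
      all_adjacent[OF T4 xy that(1)] xy that T_M by blast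
  have bits_B: "E y m \<longleftrightarrow> E y0 m" if "y \<in> B" "m \<in> T" for y m
    using adjacent_complementary[of y x0 m] adjacent_complementary[of y0 x0 m] E_sym[OF xy(3)]
      extremal_edge.all_adjacent[OF swap T4 xy(2,1) E_sym[OF xy(3)] that(1)] xy that T_M by blast
  have "card A + card T + card ({} :: 'a set) + 1 \<le> \<alpha>"
    by (rule class_bound[OF xy(1)]) (use bits_A in blast)+
  moreover have "card B + card T + card ({} :: 'a set) + 1 \<le> \<alpha>"
    by (rule class_bound_B[OF xy(2)]) (use bits_B in blast)+
  ultimately show False
    using card_sides T4 by linarith
qed

end

section \<open>Three matching edges\<close>

text \<open>The transversal is normalised by an edge \<open>x0 y0\<close>: the bits are read at the
  ends adjacent to \<open>x0\<close>, so \<open>x0\<close> has label 111 and \<open>y0\<close> has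
  label 000. Each \<open>q\<close> is the partner of the \<open>p\<close> with the same
  index.\<close>

locale extremal_edge_3 = extremal_edge +
  fixes x0 y0 p1 p2 p3 q1 q2 q3 :: 'a
  assumes x0: "x0 \<in> nbr u - {v}" and y0: "y0 \<in> nbr v - {u}" and x0y0: "E x0 y0"
    and T_eq: "T = {p1, p2, p3}" and p_ne: "p1 \<noteq> p2" "p1 \<noteq> p3" "p2 \<noteq> p3"
    and q_M: "{q1, q2, q3} \<subseteq> matched u v"
    and pq: "E p1 q1" "E p2 q2" "E p3 q3"
    and x0_p: "E x0 p1" "E x0 p2" "E x0 p3"
begin

lemma p_M: "p1 \<in> M" "p2 \<in> M" "p3 \<in> M"
  using T_eq T_M by blast+

lemma card_T: "card T = 3"
  using p_ne by (simp add: T_eq)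

lemma p_indep: "\<not> E p1 p2" "\<not> E p1 p3" "\<not> E p2 p3"
  using T_indep by (auto simp: T_eq)

lemma y0_p: "\<not> E y0 p1" "\<not> E y0 p2" "\<not> E y0 p3"
  using adjacent_complementary[OF _ _ x0y0] x0 y0 x0_p p_M by blast+

lemma q_bits:
  assumes "z \<in> A \<union> B"
  shows "E z q1 \<longleftrightarrow> \<not> E z p1" "E z q2 \<longleftrightarrow> \<not> E z p2" "E z q3 \<longleftrightarrow> \<not> E z p3"
  using exactly_one[OF assms] p_M q_M pq by auto

lemma opposite_bits:
  assumes "x \<in> A" "y \<in> B" "\<not> E x y"
  shows "E x p1 = E y p1 \<and> E x p2 = E y p2 \<or> E x p1 = E y p1 \<and> E x p3 = E y p3
    \<or> E x p2 = E y p2 \<and> E x p3 = E y p3"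
  using opposite_near[OF assms, of p1 p2] opposite_near[OF assms, of p1 p3]
    opposite_near[OF assms, of p2 p3] p_M p_ne p_indep by blast

text \<open>Complementary labels are necessary for adjacency, and non-adjacent vertices on opposite
  sides agree in at least two of the three bits.\<close>

lemma adjacent_iff:
  assumes "x \<in> A" "y \<in> B"
  shows "E x y \<longleftrightarrow> E x p1 \<noteq> E y p1 \<and> E x p2 \<noteq> E y p2 \<and> E x p3 \<noteq> E y p3"
  using opposite_bits[OF assms] adjacent_complementary[of x y] assms p_M by blast

lemma same_side_bits:
  assumes "z \<in> A \<union> B" "z' \<in> A \<union> B" "\<not> E z z'"
  shows "E z p1 = E z' p1 \<or> E z p2 = E z' p2 \<or> E z p3 = E z' p3"
  using nonadjacent_near[OF assms, of p1 p2 p3] p_M p_ne p_indep by blast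

text \<open>Exactly the labels with an odd number of ones: comparison with \<open>y0\<close> (000)
  leaves 111 or at most one 1, and comparison with \<open>x0\<close> (111) excludes 000.\<close>

lemma A_bits:
  assumes x: "x \<in> A"
  shows "(E x p1, E x p2, E x p3) \<in>
    {(True, True, True), (True, False, False), (False, True, False), (False, False, True)}"
  using opposite_bits[of x y0] adjacent_iff[of x y0] same_side_bits[of x x0] x x0 y0
    A_indep[of x x0] x0_p y0_p by auto

lemma B_bits:
  assumes y: "y \<in> B"
  shows "(E y p1, E y p2, E y p3) \<in>
    {(False, False, False), (False, True, True), (True, False, True), (True, True, False)}"
  using opposite_bits[of x0 y] adjacent_iff[of x0 y] same_side_bits[of y y0] y x0 y0
    B_indep[of y y0] x0_p y0_p by auto

lemma not_isolated_A:
  assumes w: "w \<in> I" and x: "x \<in> A"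
  shows "\<not> E w x"
proof
  assume wx: "E w x"
  \<comment> \<open>A vertex \<open>x'\<close> of \<open>A\<close> adjacent to some \<open>y \<in> Y\<close> would form a triangle with \<open>w\<close> and \<open>y\<close>,
    so \<open>A \<union> Y\<close> is independent.\<close>
  define Y where "Y = {y \<in> B. \<not> E x y}"
  define Y' where "Y' = {y \<in> B. E x y}"
  have no_edge: "\<not> E x' y" if x': "x' \<in> A" and y: "y \<in> Y" for x' y
  proof
    assume x'y: "E x' y"
    have y: "y \<in> B" "\<not> E x y" using y by (auto simp: Y_def)
    have same: "E w x \<longleftrightarrow> E w x'" if "m \<in> M" "m' \<in> M" "m \<noteq> m'" "\<not> E m m'"
      "E x m \<noteq> E x' m" "E x m' \<noteq> E x' m'" for m m'
      using isolated_same_side[OF _ _ A_indep[OF x x'] w that] x x' by blast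
    \<comment> \<open>Both labels are odd and they are distinct, since \<open>y\<close> is adjacent
      to \<open>x'\<close> but not to \<open>x\<close>. Hence they differ in exactly two bits, and
      \<open>same\<close> applies.\<close>
    have "E w x'"
      using wx same[of p1 p2] same[of p1 p3] same[of p2 p3] p_M p_ne p_indep A_bits[OF x] A_bits[OF x']
        x'y y adjacent_iff[OF x y(1)] adjacent_iff[OF x' y(1)] by auto
    \<comment> \<open>The labels of \<open>x\<close> and \<open>y\<close> have opposite parity, so
      they differ in some bit.\<close>
    moreover have "E w y"
      using wx isolated_opposite_side[OF x y w, of p1] isolated_opposite_side[OF x y w, of p2]
        isolated_opposite_side[OF x y w, of p3] p_M A_bits[OF x] B_bits[OF y(1)] by auto
    ultimately show False
      using triangle x'y by blast
  qed
  have fin: "finite A" "finite Y" "finite Y'"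
    using finite_nbr by (auto simp: Y_def Y'_def)
  have "card (A \<union> Y) \<le> \<alpha>"
  proof (rule indep)
    show "A \<union> Y \<subseteq> V" using nbr_V by (auto simp: Y_def)
    show "\<not> E a b" if "a \<in> A \<union> Y" "b \<in> A \<union> Y" for a b
      using that no_edge E_sym A_indep B_indep unfolding Y_def by blast
  qed
  moreover have "A \<inter> Y = {}"
    using A_uv B_uv unfolding Y_def by blast
  ultimately have AY: "card A + card Y \<le> \<alpha>"
    using fin by (simp add: card_Un_disjoint)
  have "B = Y \<union> Y'" "Y \<inter> Y' = {}"
    by (auto simp: Y_def Y'_def)
  then have B: "card B = card Y + card Y'"
    using card_Un_disjoint[OF fin(2,3)] by metis
  \<comment> \<open>All of \<open>Y'\<close> carries the label complementary to that of
    \<open>x\<close>. The class bound needs a member, so the empty case is treated apart.\<close>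
  have "card Y' + 4 \<le> \<alpha>"
  proof (cases "Y' = {}")
    case True
    then show ?thesis using card_I_le card_T by simp
  next
    case False
    then obtain y where y: "y \<in> Y'" by blast
    have "card Y' + card T + card ({} :: 'a set) + 1 \<le> \<alpha>"
    proof (rule class_bound_B[OF y])
      show "E y' m \<longleftrightarrow> E y m" if "y' \<in> Y'" "m \<in> T" for y' m
        using adjacent_complementary[of x y' m] adjacent_complementary[of x y m] that x y T_M
        unfolding Y'_def by blast
    qed (auto simp: Y'_def)
    then show ?thesis using card_T by simp
  qed
  \<comment> \<open>The sum of the two bounds is \<open>card A + card B + 4\<close> \<le> 2\<alpha>,
    one more than \<open>card_sides\<close> allows.\<close>
  then show False
    using AY B card_sides card_T by linarith
qed

lemma q_in_M: "q1 \<in> M" "q2 \<in> M" "q3 \<in> M"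
  using q_M by blast+

lemma q_ne: "q1 \<noteq> q2" "q1 \<noteq> q3" "q2 \<noteq> q3"
  using pairs_disjoint[of p1 p2 q1 q2] pairs_disjoint[of p1 p3 q1 q3]
    pairs_disjoint[of p2 p3 q2 q3] q_in_M p_M p_ne p_indep pq by blast+

lemma q_eq: "{q1, q2, q3} = M - T"
proof (rule card_subset_eq)
  show "finite (M - T)" using finite_M by simp
  show "{q1, q2, q3} \<subseteq> M - T"
    using q_in_M pq T_pair p_M T_eq by blast
  show "card {q1, q2, q3} = card (M - T)"
    using card_M card_T q_ne T_sub finite_T by (simp add: card_Diff_subset)
qed

text \<open>Exchanging \<open>u\<close> and \<open>v\<close> makes \<open>y0\<close> the vertex with
  label 111, so the \<open>p\<close> and the \<open>q\<close> trade places and the transversal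
  becomes its complement in \<open>M\<close>.\<close>

lemma swap_3: "extremal_edge_3 V E \<alpha> v u {q1, q2, q3} y0 x0 q1 q2 q3 p1 p2 p3"
proof -
  have "E y0 q1" "E y0 q2" "E y0 q3"
    using q_bits[of y0] y0 y0_p by blast+
  then show ?thesis
    using x0 y0 E_sym[OF x0y0] E_sym[OF uv] E_sym[OF pq(1)] E_sym[OF pq(2)] E_sym[OF pq(3)]
      q_ne p_M T_pair
    by unfold_locales (unfold matched_commute[of v u] q_eq, blast+)
qed

text \<open>A vertex \<open>w\<close> of \<open>I\<close> could be added to the independent sets
  \<open>nbr u\<close> and \<open>nbr v\<close>. Both then have at most \<alpha> - 1 elements, which
  makes \<open>card A + card B\<close> too small for \<open>card_sides\<close>.\<close>

lemma I_empty: "I = {}"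
proof (rule ccontr)
  assume "I \<noteq> {}"
  then obtain w where w: "w \<in> I" by blast
  have "\<not> E w z" if "z \<in> A \<union> B" for z
    using that not_isolated_A[OF w] extremal_edge_3.not_isolated_A[OF swap_3, of w z] w
    unfolding matched_commute[of v u] rest_commute[of v u] by blast
  then have w_indep: "\<not> E w z" if "z \<in> nbr u \<union> nbr v" for z
    using that w uv_rest by blast
  have bound: "card (nbr a) + 1 \<le> \<alpha>" if "a = u \<or> a = v" for a
  proof -
    have "card (insert w (nbr a)) \<le> \<alpha>"
    proof (rule indep)
      show "insert w (nbr a) \<subseteq> V" using w rest_V nbr_V by blast
      show "\<not> E b c" if "b \<in> insert w (nbr a)" "c \<in> insert w (nbr a)" for b c
        using that \<open>a = u \<or> a = v\<close> w_indep irrefl triangle E_sym unfolding nbr_def by blast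
    qed
    moreover have "w \<notin> nbr a"
      using w uv_rest \<open>a = u \<or> a = v\<close> unfolding nbr_def by blast
    ultimately show ?thesis using finite_nbr by simp
  qed
  have "card A + 1 = card (nbr u)" "card B + 1 = card (nbr v)"
    using card_A extremal_edge.card_A[OF swap] by simp_all
  then show False
    using bound[of u] bound[of v] card_sides card_T by simp
qed

lemma A_class:
  assumes "C \<subseteq> A" "x \<in> C" "\<And>x'. x' \<in> C \<Longrightarrow> (E x' p1, E x' p2, E x' p3) = (E x p1, E x p2, E x p3)"
  shows "card C + 4 \<le> \<alpha>"
proof -
  have "card C + card T + card ({} :: 'a set) + 1 \<le> \<alpha>"
    using assms by (intro class_bound) (auto simp: T_eq)
  then show ?thesis by (simp add: card_T)
qed

text \<open>The class of \<open>x0\<close> alone gives 5 \<le> \<alpha>. Conversely 3\<alpha> + 1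
  \<le> \<open>card A + card B + 8\<close> \<le> 2\<alpha> + 6, so equality holds
  throughout.\<close>

lemma sizes: "\<alpha> = 5" "card A = 4" "card B = 4"
proof -
  have "card {x0} + 4 \<le> \<alpha>"
    using x0 by (intro A_class) auto
  then show "\<alpha> = 5" "card A = 4" "card B = 4"
    using card_V I_empty card_T large card_A_le card_B_le by simp_all
qed

lemma A_bits_inj: "inj_on (\<lambda>x. (E x p1, E x p2, E x p3)) A"
proof (rule inj_onI, rule ccontr)
  fix x x' assume x: "x \<in> A" "x' \<in> A" "(E x p1, E x p2, E x p3) = (E x' p1, E x' p2, E x' p3)"
    and "x \<noteq> x'"
  have "card {x, x'} + 4 \<le> \<alpha>"
    using x by (intro A_class[of _ x]) auto
  with \<open>x \<noteq> x'\<close> show False by (simp add: sizes)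
qed

text \<open>The four vertices have distinct labels and therefore use up the four odd ones; the index
  names the only bit that is set, except for \<open>x0\<close>.\<close>

lemma A_elements:
  obtains x1 x2 x3 where "A = {x0, x1, x2, x3}"
    and "E x1 p1" "\<not> E x1 p2" "\<not> E x1 p3"
    and "\<not> E x2 p1" "E x2 p2" "\<not> E x2 p3"
    and "\<not> E x3 p1" "\<not> E x3 p2" "E x3 p3"
proof -
  let ?b = "\<lambda>x. (E x p1, E x p2, E x p3)"
  let ?S = "{(True, True, True), (True, False, False), (False, True, False), (False, False, True)}"
  have im: "?b ` A = ?S"
  proof (rule card_subset_eq)
    show "?b ` A \<subseteq> ?S" using A_bits by (rule image_subsetI)
    show "card (?b ` A) = card ?S"
      using card_image[OF A_bits_inj] sizes by simp
  qed simp
  have "(True, False, False) \<in> ?b ` A" "(False, True, False) \<in> ?b ` A" "(False, False, True) \<in> ?b ` A"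
    unfolding im by simp_all
  then obtain x1 x2 x3 where x: "x1 \<in> A" "x2 \<in> A" "x3 \<in> A"
    and b: "?b x1 = (True, False, False)" "?b x2 = (False, True, False)" "?b x3 = (False, False, True)"
    by (elim imageE) (metis (no_types))
  have b0: "?b x0 = (True, True, True)" using x0_p by simp
  have "A = {x0, x1, x2, x3}"
  proof
    show "{x0, x1, x2, x3} \<subseteq> A" using x x0 by blast
    show "A \<subseteq> {x0, x1, x2, x3}"
    proof
      fix x assume xA: "x \<in> A"
      then have "?b x \<in> {?b x0, ?b x1, ?b x2, ?b x3}"
        using A_bits[OF xA] unfolding b0 b by blast
      then show "x \<in> {x0, x1, x2, x3}"
        using inj_onD[OF A_bits_inj _ xA] x x0 by blast
    qed
  qed
  then show thesis
    by (rule that) (use b in simp_all)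
qed

end

section \<open>Degrees of the non-isolated vertices\<close>

context extremal_edge
begin

text \<open>The given transversal is exchanged for the set of neighbours of \<open>x0\<close> in
  \<open>M\<close>, which also contains one end of each matching edge.\<close>

lemma refine_3:
  assumes "card T = 3"
  obtains x0 y0 p1 p2 p3 q1 q2 q3 where
    "extremal_edge_3 V E \<alpha> u v {p1, p2, p3} x0 y0 p1 p2 p3 q1 q2 q3"
proof -
  obtain x0 y0 where xy: "x0 \<in> A" "y0 \<in> B" "E x0 y0"
    by (rule exists_adjacent)
  let ?P = "{m \<in> M. E x0 m}"
  have "card ?P = 3"
    using transversal_nbr xy assms by simp
  then obtain p1 p2 p3 where P: "?P = {p1, p2, p3}" and ne: "p1 \<noteq> p2" "p1 \<noteq> p3" "p2 \<noteq> p3"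
    unfolding card_3_iff by blast
  have p: "p1 \<in> M" "p2 \<in> M" "p3 \<in> M" "E x0 p1" "E x0 p2" "E x0 p3"
    using P by blast+
  obtain q1 where q1: "q1 \<in> M" "E p1 q1" by (rule partner[OF p(1)])
  obtain q2 where q2: "q2 \<in> M" "E p2 q2" by (rule partner[OF p(2)])
  obtain q3 where q3: "q3 \<in> M" "E p3 q3" by (rule partner[OF p(3)])
  have pair: "m \<in> ?P \<longleftrightarrow> n \<notin> ?P" if "m \<in> M" "n \<in> M" "E m n" for m n
    using exactly_one[of x0 m n] that xy by blast
  have "extremal_edge V E \<alpha> u v {p1, p2, p3}"
    using uv pair p unfolding P by unfold_locales blast+
  then have "extremal_edge_3 V E \<alpha> u v {p1, p2, p3} x0 y0 p1 p2 p3 q1 q2 q3"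
    using xy ne p q1 q2 q3
    by (intro extremal_edge_3.intro extremal_edge_3_axioms.intro) blast+
  then show thesis by (rule that)
qed

text \<open>For two matching edges \<open>card_sides\<close> forces both sides to have the maximal
  size \<alpha> - 1; for three the sizes are known.\<close>

lemma card_nbr_u: "card (nbr u) = \<alpha>"
proof -
  consider "card T = 2" | "card T = 3"
    using card_T_ge_2 card_T_le_3 by linarith
  then show ?thesis
  proof cases
    case 1
    then show ?thesis
      using card_A card_A_le card_B_le card_sides by linarith
  next
    case 2
    then obtain x0 y0 p1 p2 p3 q1 q2 q3 where
      "extremal_edge_3 V E \<alpha> u v {p1, p2, p3} x0 y0 p1 p2 p3 q1 q2 q3"
      by (rule refine_3)
    then show ?thesis
      using card_A extremal_edge_3.sizes(1,2) by fastforce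
  qed
qed

end

text \<open>Any edge can play the role of \<open>u v\<close>. With two matching edges this gives the
  degree of a vertex of \<open>I\<close> that has a neighbour in
  \<open>A \<union> B\<close>.\<close>

lemma (in extremal_graph) regular: "E x y \<Longrightarrow> card (nbr x) = \<alpha>"
proof -
  assume xy: "E x y"
  obtain T where "T \<subseteq> matched x y"
    "\<And>m n. m \<in> matched x y \<Longrightarrow> n \<in> matched x y \<Longrightarrow> E m n \<Longrightarrow> m \<in> T \<longleftrightarrow> n \<notin> T"
    by (rule exists_transversal[OF xy]) blast
  then have "extremal_edge V E \<alpha> x y T"
    using xy by unfold_locales blast+
  then show ?thesis by (rule extremal_edge.card_nbr_u)
qed

section \<open>Two matching edges\<close>

locale extremal_edge_2 = extremal_edge +
  fixes p1 p2 :: 'a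
  assumes T_eq: "T = {p1, p2}" and p_ne: "p1 \<noteq> p2"
begin

lemma p_M: "p1 \<in> M" "p2 \<in> M"
  using T_eq T_M by blast+

lemma p_indep: "\<not> E p1 p2"
  using T_indep by (auto simp: T_eq)

lemma card_T: "card T = 2"
  using p_ne by (simp add: T_eq)

text \<open>With \<open>card T = 2\<close> all the counting inequalities are tight.\<close>

lemma sizes: "card A + 1 = \<alpha>" "card B + 1 = \<alpha>" "card I + 3 = \<alpha>"
  using card_V card_A_le card_B_le card_sides card_I_le large card_T by linarith+

text \<open>Otherwise the class bound for \<open>z\<close> alone with all of \<open>I\<close> gives
  \<open>card I + 4\<close> \<le> \<alpha>, one too many.\<close>

lemma not_all_missed:
  assumes "z \<in> A \<union> B"
  obtains w where "w \<in> I" "E w z"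
proof -
  have "\<exists>w\<in>I. E z w"
  proof (rule ccontr)
    assume no: "\<not> ?thesis"
    have "card {z} + card T + card I + 1 \<le> \<alpha>"
    proof (cases "z \<in> A")
      case True
      then show ?thesis using no by (intro class_bound) auto
    next
      case False
      then show ?thesis using no assms by (intro class_bound_B) auto
    qed
    then show False using sizes card_T by simp
  qed
  then show thesis using that E_sym by blast
qed

text \<open>The label parity is complemented on \<open>B\<close> because adjacent vertices then lie in different classes.\<close>
definition C :: "bool \<Rightarrow> 'a set" where
  "C c = {x \<in> A. (E x p1 = E x p2) = c} \<union> {y \<in> B. (E y p1 = E y p2) \<noteq> c}"

lemma C_sides: "z \<in> C c \<Longrightarrow> z \<in> A \<union> B"
  by (auto simp: C_def)

text \<open>Complementing both bits preserves whether they agree, so adjacent vertices from opposite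
  sides lie in different classes.\<close>

lemma C_indep:
  assumes "z \<in> C c" "z' \<in> C c"
  shows "\<not> E z z'"
proof -
  have "\<not> E x y" if "x \<in> A" "y \<in> B" "(E x p1 = E x p2) \<noteq> (E y p1 = E y p2)" for x y
    using adjacent_complementary[of x y p1] adjacent_complementary[of x y p2] that p_M by blast
  then show ?thesis
    using assms A_indep[of z z'] B_indep[of z z'] E_sym[of z z'] unfolding C_def by blast
qed

lemma C_le: "card (C c) \<le> \<alpha>"
  using C_indep nbr_V unfolding C_def by (intro indep) blast+

lemma finite_C: "finite (C c)"
  using finite_nbr by (simp add: C_def)

lemma C_Un: "C True \<union> C False = A \<union> B" and C_Int: "C True \<inter> C False = {}"
  using A_uv B_uv unfolding C_def by blast+

lemma card_C: "card (C True) + card (C False) + 2 = 2 * \<alpha>"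
proof -
  have "card (C True) + card (C False) = card (A \<union> B)"
    using card_Un_disjoint[OF finite_C finite_C C_Int] C_Un by simp
  also have "\<dots> = card A + card B"
    using A_uv B_uv finite_nbr by (intro card_Un_disjoint) blast+
  finally show ?thesis using sizes by linarith
qed

lemma C_ge: "\<alpha> \<le> card (C c) + 2"
  using card_C C_le[of True] C_le[of False] by (cases c) simp_all

text \<open>Within a class, distinct labels on the same side differ in both bits, as
  \<open>isolated_same_side\<close> requires; across the sides one differing bit is enough.\<close>

lemma C_same_nbr:
  assumes z: "z \<in> C c" "z' \<in> C c" and w: "w \<in> I" and diff: "E z p1 \<noteq> E z' p1 \<or> E z p2 \<noteq> E z' p2"
  shows "E w z \<longleftrightarrow> E w z'"
proof -
  have ne: "\<not> E z z'" "\<not> E z' z" using C_indep z by blast+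
  note opp = isolated_opposite_side[OF _ _ _ w]
  consider "z \<in> A" "z' \<in> B" | "z \<in> B" "z' \<in> A" | "E z p1 \<noteq> E z' p1" "E z p2 \<noteq> E z' p2"
    using z diff unfolding C_def by blast
  then show ?thesis
  proof cases
    case 1
    then show ?thesis using opp[OF 1 ne(1)] diff p_M by blast
  next
    case 2
    then show ?thesis using opp[OF 2(2,1) ne(2)] diff p_M by blast
  next
    case 3
    show ?thesis
      using isolated_same_side[OF C_sides[OF z(1)] C_sides[OF z(2)] ne(1) w p_M p_ne p_indep 3] .
  qed
qed

text \<open>A single label would put the whole class on one side, and the class bound would give
  \<open>card (C c) + 3\<close> \<le> \<alpha>, against \<open>C_ge\<close>.\<close>

lemma C_two_classes:
  assumes z: "z \<in> C c"
  obtains z' where "z' \<in> C c" "E z p1 \<noteq> E z' p1 \<or> E z p2 \<noteq> E z' p2"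
proof -
  have "\<exists>z'\<in>C c. E z p1 \<noteq> E z' p1 \<or> E z p2 \<noteq> E z' p2"
  proof (rule ccontr)
    assume "\<not> ?thesis"
    then have bits: "E z' p1 = E z p1 \<and> E z' p2 = E z p2" if "z' \<in> C c" for z'
      using that by blast
    have bits_T: "E z' m = E z m" if "z' \<in> C c" "m \<in> T" for z' m
      using bits that unfolding T_eq by blast
    have "card (C c) + card T + card ({} :: 'a set) + 1 \<le> \<alpha>"
    proof (cases "z \<in> A")
      case True
      then have "(E z p1 = E z p2) = c"
        using z A_uv B_uv unfolding C_def by blast
      then have "C c \<subseteq> A"
        using bits unfolding C_def by blast
      then show ?thesis using bits_T z by (intro class_bound) blast+
    next
      case False
      then have "(E z p1 = E z p2) \<noteq> c"
        using z unfolding C_def by blast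
      then have "C c \<subseteq> B"
        using bits unfolding C_def by blast
      then show ?thesis using bits_T z by (intro class_bound_B) blast+
    qed
    then show False using C_ge[of c] card_T by simp
  qed
  then show thesis using that by blast
qed

text \<open>If \<open>z'\<close> has the label of \<open>z\<close>, the detour through a member
  \<open>z''\<close> with another label applies.\<close>

lemma C_nbr:
  assumes z: "z \<in> C c" and z': "z' \<in> C c" and w: "w \<in> I" "E w z"
  shows "E w z'"
proof -
  obtain z'' where z'': "z'' \<in> C c" "E z p1 \<noteq> E z'' p1 \<or> E z p2 \<noteq> E z'' p2"
    by (rule C_two_classes[OF z])
  then have "E w z''" using C_same_nbr z w by blast
  then show ?thesis
    using C_same_nbr[OF z z' w(1)] C_same_nbr[OF z''(1) z' w(1)] z''(2) w(2) by blast
qed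

lemma card_C_eq: "card (C c) = \<alpha>"
proof -
  have \<alpha>: "3 \<le> \<alpha>" using sizes by linarith
  then have "C c \<noteq> {}" using C_ge[of c] by auto
  then obtain z where z: "z \<in> C c" by blast
  obtain w where w: "w \<in> I" "E w z"
    using not_all_missed[OF C_sides[OF z]] by blast
  have "nbr w = C c"
  proof
    show "C c \<subseteq> nbr w"
      using C_nbr[OF z _ w] unfolding nbr_def by blast
    \<comment> \<open>A neighbour in the other class would make \<open>w\<close> adjacent to all
      2\<alpha> - 2 vertices of \<open>A \<union> B\<close>, more than its degree \<alpha>, since 3
      \<le> \<alpha>.\<close>
    have "\<not> E w z'" if "z' \<in> C (\<not> c)" for z'
    proof
      assume "E w z'"
      then have "C (\<not> c) \<subseteq> nbr w"
        using C_nbr[OF that _ w(1)] unfolding nbr_def by blast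
      with \<open>C c \<subseteq> nbr w\<close> have "C True \<union> C False \<subseteq> nbr w"
        by (cases c) auto
      then have "card (C True \<union> C False) \<le> card (nbr w)"
        using finite_nbr by (rule card_mono[rotated])
      then have "card (C True) + card (C False) \<le> \<alpha>"
        using card_Un_disjoint[OF finite_C finite_C C_Int] regular[OF w(2)] by simp
      then show False using card_C \<alpha> by linarith
    qed
    moreover have "nbr w \<subseteq> A \<union> B"
    proof
      fix y assume "y \<in> nbr w"
      then have "E w y" by (simp add: nbr_iff)
      moreover have "y \<noteq> u" "y \<noteq> v" "y \<notin> rest u v"
        using \<open>E w y\<close> w(1) uv_rest I_isolated by blast+
      ultimately show "y \<in> A \<union> B"
        using E_V2 unfolding nbr_def rest_def by blast
    qed
    ultimately show "nbr w \<subseteq> C c"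
      using C_Un unfolding nbr_def by (cases c) auto
  qed
  then show ?thesis using regular[OF w(2)] by simp
qed

lemma contradiction: False
  using card_C card_C_eq by simp

end

lemma (in extremal_edge) card_T_eq_3: "card T = 3"
proof (rule ccontr)
  assume "card T \<noteq> 3"
  then have "card T = 2"
    using card_T_ge_2 card_T_le_3 by linarith
  then obtain p1 p2 where "T = {p1, p2}" "p1 \<noteq> p2"
    unfolding card_2_iff by blast
  then have "extremal_edge_2 V E \<alpha> u v T p1 p2"
    by unfold_locales
  then show False by (rule extremal_edge_2.contradiction)
qed

section \<open>Identification of the extremal graph\<close>

context extremal_edge_3
begin

lemma V_eq: "V = {u, v} \<union> A \<union> B \<union> {p1, p2, p3, q1, q2, q3}"
proof -
  have "M = {p1, p2, p3, q1, q2, q3}"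
    using q_eq T_eq T_sub by blast
  moreover have "V = {u, v} \<union> A \<union> B \<union> rest u v"
    using uv E_V E_V2 unfolding nbr_def rest_def by blast
  moreover have "rest u v = M"
    using I_empty M_rest by blast
  ultimately show ?thesis by metis
qed

lemma card_V_eq: "card V = 16"
  using card_V sizes I_empty card_T by simp

lemma matching_nonadjacent:
  "\<not> E p1 q2" "\<not> E p1 q3" "\<not> E p2 q1" "\<not> E p2 q3" "\<not> E p3 q1" "\<not> E p3 q2"
  using partner_unique[OF p_M(1) q_in_M(1) q_in_M(2) pq(1)]
    partner_unique[OF p_M(1) q_in_M(1) q_in_M(3) pq(1)]
    partner_unique[OF p_M(2) q_in_M(2) q_in_M(1) pq(2)]
    partner_unique[OF p_M(2) q_in_M(2) q_in_M(3) pq(2)]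
    partner_unique[OF p_M(3) q_in_M(3) q_in_M(1) pq(3)]
    partner_unique[OF p_M(3) q_in_M(3) q_in_M(2) pq(3)] q_ne by metis+

lemma iso_hstar:
  obtains f where "bij_betw f UNIV V" "\<And>a b. E (f a) (f b) \<longleftrightarrow> (a, b) \<in> parcs hstar"
proof -
  obtain x1 x2 x3 where A: "A = {x0, x1, x2, x3}"
    and x: "E x1 p1" "\<not> E x1 p2" "\<not> E x1 p3" "\<not> E x2 p1" "E x2 p2" "\<not> E x2 p3"
      "\<not> E x3 p1" "\<not> E x3 p2" "E x3 p3"
    by (rule A_elements)
  obtain y1 y2 y3 where B: "B = {y0, y1, y2, y3}"
    and y: "E y1 q1" "\<not> E y1 q2" "\<not> E y1 q3" "\<not> E y2 q1" "E y2 q2" "\<not> E y2 q3"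
      "\<not> E y3 q1" "\<not> E y3 q2" "E y3 q3"
    by (rule extremal_edge_3.A_elements[OF swap_3])
  have xA: "x0 \<in> A" "x1 \<in> A" "x2 \<in> A" "x3 \<in> A" and yB: "y0 \<in> B" "y1 \<in> B" "y2 \<in> B" "y3 \<in> B"
    using A B by blast+
  have mR: "p1 \<in> rest u v" "p2 \<in> rest u v" "p3 \<in> rest u v" "q1 \<in> rest u v" "q2 \<in> rest u v" "q3 \<in> rest u v"
    using p_M q_in_M M_rest by blast+
  have xU: "x0 \<in> A \<union> B" "x1 \<in> A \<union> B" "x2 \<in> A \<union> B" "x3 \<in> A \<union> B"
    and yU: "y0 \<in> A \<union> B" "y1 \<in> A \<union> B" "y2 \<in> A \<union> B" "y3 \<in> A \<union> B"
    using xA yB by blast+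
  have yp: "\<not> E y1 p1" "E y1 p2" "E y1 p3" "E y2 p1" "\<not> E y2 p2" "E y2 p3"
    "E y3 p1" "E y3 p2" "\<not> E y3 p3"
    using y q_bits[OF yU(2)] q_bits[OF yU(3)] q_bits[OF yU(4)] by blast+
  have xq: "\<not> E x1 q1" "E x1 q2" "E x1 q3" "E x2 q1" "\<not> E x2 q2" "E x2 q3"
    "E x3 q1" "E x3 q2" "\<not> E x3 q3" "\<not> E x0 q1" "\<not> E x0 q2" "\<not> E x0 q3"
    using x x0_p q_bits[OF xU(1)] q_bits[OF xU(2)] q_bits[OF xU(3)] q_bits[OF xU(4)] by blast+
  have y0q: "E y0 q1" "E y0 q2" "E y0 q3"
    using y0_p q_bits[OF yU(1)] by blast+
  note q_indep = extremal_edge_3.p_indep[OF swap_3]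
  have xy: "E a b \<longleftrightarrow> E a p1 \<noteq> E b p1 \<and> E a p2 \<noteq> E b p2 \<and> E a p3 \<noteq> E b p3"
    if "a \<in> {x0, x1, x2, x3}" "b \<in> {y0, y1, y2, y3}" for a b
    using adjacent_iff[of a b] that unfolding A B by blast
  note fwd = x yp xq y0q y x0_p y0_p pq p_indep q_indep matching_nonadjacent
  have nE: "\<not> E b a" if "\<not> E a b" for a b
    using that E_sym by blast
  \<comment> \<open>\<open>hz\<close> goes to \<open>u\<close> and \<open>hb 0\<close> to
    \<open>v\<close>, so the other \<open>hb\<close> form \<open>A\<close>. The remaining neighbours
    \<open>hv 1\<close>, \<open>hv 4\<close>, \<open>ha 2\<close>, \<open>ha 3\<close> of
    \<open>hb 0\<close> form \<open>B\<close>, and the matching edges are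
    \<open>hv 0\<close>-\<open>ha 0\<close>, \<open>hv 2\<close>-\<open>hv 3\<close> and
    \<open>ha 4\<close>-\<open>ha 1\<close>.\<close>
  define f where "f = case_hstar_vertex
    (\<lambda>i. if i = 0 then p1 else if i = 1 then y3 else if i = 2 then p2 else if i = 3 then q2 else y2)
    (\<lambda>i. if i = 0 then q1 else if i = 1 then q3 else if i = 2 then y1 else if i = 3 then y0 else p3)
    (\<lambda>i. if i = 0 then v else if i = 1 then x0 else if i = 2 then x3 else if i = 3 then x2 else x1)
    u"
  have f: "f (hv 0) = p1" "f (hv 1) = y3" "f (hv 2) = p2" "f (hv 3) = q2" "f (hv 4) = y2"
    "f (ha 0) = q1" "f (ha 1) = q3" "f (ha 2) = y1" "f (ha 3) = y0" "f (ha 4) = p3"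
    "f (hb 0) = v" "f (hb 1) = x0" "f (hb 2) = x3" "f (hb 3) = x2" "f (hb 4) = x1" "f hz = u"
    by (simp_all add: f_def)
  have uvA: "E u a" "E a u" "\<not> E v a" "\<not> E a v" if "a \<in> {x0, x1, x2, x3}" for a
    using A_uv[of a] that unfolding A by blast+
  have uvB: "E v a" "E a v" "\<not> E u a" "\<not> E a u" if "a \<in> {y0, y1, y2, y3}" for a
    using B_uv[of a] that unfolding B by blast+
  have uvM: "\<not> E u a" "\<not> E a u" "\<not> E v a" "\<not> E a v" if "a \<in> {p1, p2, p3, q1, q2, q3}" for a
    using uv_rest[of a] mR that by blast+
  have AA: "\<not> E a b" if "a \<in> {x0, x1, x2, x3}" "b \<in> {x0, x1, x2, x3}" for a b
    using A_indep[of a b] that unfolding A by blast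
  have BB: "\<not> E a b" if "a \<in> {y0, y1, y2, y3}" "b \<in> {y0, y1, y2, y3}" for a b
    using B_indep[of a b] that unfolding B by blast
  have yx: "E b a \<longleftrightarrow> E a p1 \<noteq> E b p1 \<and> E a p2 \<noteq> E b p2 \<and> E a p3 \<noteq> E b p3"
    if "a \<in> {x0, x1, x2, x3}" "b \<in> {y0, y1, y2, y3}" for a b
    using xy[OF that] E_commute by blast
  have pos: "E p1 a \<longleftrightarrow> E a p1" "E p2 a \<longleftrightarrow> E a p2" "E p3 a \<longleftrightarrow> E a p3"
    "E q1 a \<longleftrightarrow> E a q1" "E q2 a \<longleftrightarrow> E a q2" "E q3 a \<longleftrightarrow> E a q3"
    if "a \<in> {x0, x1, x2, x3, y0, y1, y2, y3}" for a
    by (rule E_commute)+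
  have qp: "E q1 a \<longleftrightarrow> E a q1" "E q2 a \<longleftrightarrow> E a q2" "E q3 a \<longleftrightarrow> E a q3"
    if "a \<in> {p1, p2, p3}" for a
    by (rule E_commute)+
  have pp: "\<not> E a b" if "a \<in> {p1, p2, p3}" "b \<in> {p1, p2, p3}" for a b
    using that p_indep nE irrefl by blast
  have qq: "\<not> E a b" if "a \<in> {q1, q2, q3}" "b \<in> {q1, q2, q3}" for a b
    using that q_indep nE irrefl by blast
  have adj: "\<forall>a b. E (f a) (f b) \<longleftrightarrow> (a, b) \<in> parcs hstar"
    unfolding all_hstar_vertex all_5 f
    by (simp add: parcs_hstar uv E_sym[OF uv] irrefl uvA uvB uvM AA BB xy yx pos qp pp qq fwd)
  have "V \<subseteq> range f"
  proof -
    have "{u, v} \<union> {x0, x1, x2, x3} \<union> {y0, y1, y2, y3} \<union> {p1, p2, p3, q1, q2, q3} \<subseteq> range f"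
      unfolding f(1-16)[symmetric] by blast
    then show ?thesis using V_eq A B by metis
  qed
  moreover have "range f \<subseteq> V"
  proof -
    have "\<forall>a. f a \<in> {u, v} \<union> {x0, x1, x2, x3} \<union> {y0, y1, y2, y3} \<union> {p1, p2, p3, q1, q2, q3}"
      unfolding all_hstar_vertex all_5 f by simp
    then show ?thesis using V_eq A B by blast
  qed
  ultimately have range: "range f = V" by blast
  \<comment> \<open>A map from 16 vertices onto a set of 16 vertices is injective.\<close>
  have "inj f"
    using range card_V_eq card_hstar_vertex card_gt_0_iff[of "UNIV :: hstar_vertex set"]
    by (intro eq_card_imp_inj_on) simp_all
  with range have "bij_betw f UNIV V"
    by (simp add: bij_betw_def)
  then show thesis
    using adj by (intro that) blast+
qed

end

lemma (in extremal_graph) extremal_hstar: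
  obtains f where "\<alpha> = 5" "card V = 16" "bij_betw f UNIV V"
    "\<And>a b. E (f a) (f b) \<longleftrightarrow> (a, b) \<in> parcs hstar"
proof -
  \<comment> \<open>Without an edge \<open>V\<close> itself would be independent, although it has
    more than \<alpha> elements.\<close>
  obtain u v where uv: "E u v"
    using indep[of V] large by fastforce
  obtain T where "T \<subseteq> matched u v"
    "\<And>m n. m \<in> matched u v \<Longrightarrow> n \<in> matched u v \<Longrightarrow> E m n \<Longrightarrow> m \<in> T \<longleftrightarrow> n \<notin> T"
    by (rule exists_transversal[OF uv]) blast
  then interpret extremal_edge V E \<alpha> u v T
    using uv by unfold_locales blast+
  obtain x0 y0 p1 p2 p3 q1 q2 q3 where
    "extremal_edge_3 V E \<alpha> u v {p1, p2, p3} x0 y0 p1 p2 p3 q1 q2 q3"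
    by (rule refine_3[OF card_T_eq_3])
  then interpret three: extremal_edge_3 V E \<alpha> u v "{p1, p2, p3}" x0 y0 p1 p2 p3 q1 q2 q3 .
  show thesis
    by (rule three.iso_hstar) (rule that[OF three.sizes(1) three.card_V_eq])
qed

section \<open>Cliques, and the return to the original graph\<close>

lemma finite_cliques: "finite (pverts G) \<Longrightarrow> finite {S. clique G S}"
  by (rule finite_subset[of _ "Pow (pverts G)"]) (auto simp: clique_def)

lemma card_clique_le: "finite (pverts G) \<Longrightarrow> clique G S \<Longrightarrow> card S \<le> clique_number G"
  unfolding clique_number_def by (intro Max_ge) (simp_all add: finite_cliques)

lemma clique_number_attained:
  assumes "finite (pverts G)"
  obtains S where "clique G S" "card S = clique_number G"
proof -
  have "clique G {}" by (simp add: clique_def)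
  then have "clique_number G \<in> card ` {S. clique G S}"
    unfolding clique_number_def using finite_cliques[OF assms] by (intro Max_in) auto
  then show thesis using that by auto
qed

lemma parcs_three_K1: "(u, v) \<notin> parcs three_K1"
  by (simp add: three_K1_def graph_of_def)

text \<open>Triangles of the complement are copies of 3K_1 in \<open>G\<close>, induced copies of
  P_2 \<union> P_3 there are paragliders in \<open>G\<close>, and independent sets there are cliques
  of \<open>G\<close>.\<close>

lemma extremal_complement:
  assumes G: "pair_graph G" and free: "graph_free {three_K1, paraglider} G"
    and large: "3 * clique_number G + 1 \<le> card (pverts G)"
  shows "extremal_graph (pverts G) (\<lambda>x y. (x, y) \<in> parcs (complement G)) (clique_number G)"
proof -
  interpret pair_graph G by (rule G)
  define E where "E = (\<lambda>x y. (x, y) \<in> parcs (complement G))"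
  have E_iff: "E x y \<longleftrightarrow> x \<in> pverts G \<and> y \<in> pverts G \<and> x \<noteq> y \<and> (x, y) \<notin> parcs G" for x y
    by (simp add: E_def complement_def)
  have sym: "(x, y) \<in> parcs G \<longleftrightarrow> (y, x) \<in> parcs G" for x y
    using pair_sym_arcs by (auto simp: symmetric_def sym_def)
  have no_loop: "(x, x) \<notin> parcs G" for x
    using pair_no_loops by fastforce
  have arc_iff: "(x, y) \<in> parcs G \<longleftrightarrow> x \<noteq> y \<and> \<not> E x y" if "x \<in> pverts G" "y \<in> pverts G" for x y
    using that no_loop by (auto simp: E_iff)
  have E_sym: "E x y \<Longrightarrow> E y x" for x y
    using sym by (auto simp: E_iff)
  have wf: "pair_wf_digraph G" by unfold_locales
  have tri: "\<not> E x z" if "E x y" "E y z" for x y z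
  proof
    assume "E x z"
    define f where "f i = (if i = 0 then x else if i = 1 then y else z)" for i :: nat
    have "\<not> graph_free {three_K1, paraglider} G"
    proof (rule not_graph_free[OF wf, of three_K1 _ f])
      show "pair_wf_digraph three_K1"
        unfolding three_K1_def by (rule wf_graph_of) simp
      show "inj_on f (pverts three_K1)" "f ` pverts three_K1 \<subseteq> pverts G"
        using \<open>E x y\<close> \<open>E y z\<close> \<open>E x z\<close>
        by (auto simp: three_K1_def graph_of_def inj_on_def f_def E_iff)
      show "(f i, f j) \<in> parcs G \<longleftrightarrow> (i, j) \<in> parcs three_K1"
        if "i \<in> pverts three_K1" "j \<in> pverts three_K1" for i j
        using \<open>E x y\<close> \<open>E y z\<close> \<open>E x z\<close> E_sym[OF \<open>E x y\<close>] E_sym[OF \<open>E y z\<close>] E_sym[OF \<open>E x z\<close>] no_loop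
        by (auto simp: parcs_three_K1 f_def E_iff)
    qed simp
    then show False using free by blast
  qed
  have "extremal_graph (pverts G) E (clique_number G)"
  proof
    show "finite (pverts G)" by (rule pair_finite_verts)
    show "x \<in> pverts G" if "E x y" for x y using that by (simp add: E_iff)
    show "E y x" if "E x y" for x y using that by (rule E_sym)
    show "\<not> E x z" if "E x y" "E y z" for x y z using that by (rule tri)
    show "E a c \<or> E a d \<or> E a e \<or> E b c \<or> E b d \<or> E b e"
      if edges: "E a b" "E c d" "E d e" "c \<noteq> e" for a b c d e
    proof (rule ccontr)
      assume no: "\<not> ?thesis"
      have V: "a \<in> pverts G" "b \<in> pverts G" "c \<in> pverts G" "d \<in> pverts G" "e \<in> pverts G"
        using edges by (auto simp: E_iff)
      have "\<not> E c e" using edges(2,3) by (rule tri)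
      \<comment> \<open>In \<open>G\<close> the 4-cycle is \<open>a c b d\<close>, and
        \<open>e\<close> is adjacent to all of it but \<open>d\<close>; the arc between
        \<open>c\<close> and \<open>e\<close> comes from the absence of triangles in the
        complement.\<close>
      define f where "f i = (if i = 0 then a else if i = 1 then c else if i = 2 then b
        else if i = 3 then d else e)" for i :: nat
      have ne: "a \<noteq> b" "a \<noteq> c" "a \<noteq> d" "a \<noteq> e" "b \<noteq> c" "b \<noteq> d" "b \<noteq> e" "c \<noteq> d" "c \<noteq> e" "d \<noteq> e"
        using no edges E_sym E_iff by metis+
      have arcs: "(a, b) \<notin> parcs G" "(c, d) \<notin> parcs G" "(d, e) \<notin> parcs G"
        "(a, c) \<in> parcs G" "(a, d) \<in> parcs G" "(a, e) \<in> parcs G" "(b, c) \<in> parcs G"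
        "(b, d) \<in> parcs G" "(b, e) \<in> parcs G" "(c, e) \<in> parcs G"
        using no edges \<open>\<not> E c e\<close> ne V unfolding E_iff by blast+
      have arcs': "(b, a) \<notin> parcs G" "(d, c) \<notin> parcs G" "(e, d) \<notin> parcs G"
        "(c, a) \<in> parcs G" "(d, a) \<in> parcs G" "(e, a) \<in> parcs G" "(c, b) \<in> parcs G"
        "(d, b) \<in> parcs G" "(e, b) \<in> parcs G" "(e, c) \<in> parcs G"
        using arcs sym by blast+
      have "\<not> graph_free {three_K1, paraglider} G"
      proof (rule not_graph_free[OF wf, of paraglider _ f])
        show "pair_wf_digraph paraglider"
          unfolding paraglider_def by (rule wf_graph_of) simp
        show "inj_on f (pverts paraglider)" "f ` pverts paraglider \<subseteq> pverts G"
          using ne V by (auto simp: paraglider_def graph_of_def inj_on_def f_def)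
        show "(f i, f j) \<in> parcs G \<longleftrightarrow> (i, j) \<in> parcs paraglider"
          if "i \<in> pverts paraglider" "j \<in> pverts paraglider" for i j
          using that arcs arcs' no_loop
          by (simp add: paraglider_def graph_of_def) (elim disjE; simp add: f_def)
      qed simp
      then show False using free by blast
    qed
    show "card S \<le> clique_number G" if "S \<subseteq> pverts G" "\<And>x y. x \<in> S \<Longrightarrow> y \<in> S \<Longrightarrow> \<not> E x y" for S
      using that by (intro card_clique_le pair_finite_verts) (auto simp: clique_def E_iff)
    show "3 * clique_number G + 1 \<le> card (pverts G)" by (rule large)
  qed
  then show ?thesis by (simp add: E_def)
qed

lemma extremal_iso:
  assumes G: "pair_graph G" and free: "graph_free {three_K1, paraglider} G"
    and large: "3 * clique_number G + 1 \<le> card (pverts G)"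
  shows "card (pverts G) = 3 * clique_number G + 1 \<and> graph_iso G (complement hstar)"
proof -
  interpret pair_graph G by (rule G)
  interpret extremal_graph "pverts G" "\<lambda>x y. (x, y) \<in> parcs (complement G)" "clique_number G"
    by (rule extremal_complement[OF assms])
  obtain f where size: "clique_number G = 5" "card (pverts G) = 16"
    and bij: "bij_betw f UNIV (pverts G)"
    and adj: "\<And>a b. (f a, f b) \<in> parcs (complement G) \<longleftrightarrow> (a, b) \<in> parcs hstar"
    by (rule extremal_hstar) blast
  have V: "f a \<in> pverts G" for a
    using bij by (auto simp: bij_betw_def)
  have inj: "f a = f b \<longleftrightarrow> a = b" for a b
    using bij by (auto simp: bij_betw_def inj_def)
  have no_loop: "(x, x) \<notin> parcs G" for x
    using pair_no_loops by fastforce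
  have "graph_iso (complement hstar) G"
  proof (rule graph_isoI[OF wf_complement _, of G f])
    show "pair_wf_digraph G" by unfold_locales
    show "bij_betw f (pverts (complement hstar)) (pverts G)"
      using bij by (simp add: complement_def hstar_def graph_of_def)
    show "(f a, f b) \<in> parcs G \<longleftrightarrow> (a, b) \<in> parcs (complement hstar)" for a b
      using adj[of a b] V[of a] V[of b] inj[of a b] no_loop
      by (auto simp: complement_def hstar_def graph_of_def)
  qed
  then have "graph_iso G (complement hstar)"
    by (rule graph_iso_sym[OF wf_complement])
  with size show ?thesis by simp
qed

text \<open>The isomorphism carries a maximum clique to an independent set of \<open>hstar\<close>.
  Only the upper bound 5 is proved here; the reverse one follows from the general inequality with
  \<open>n\<close> = 16.\<close>

lemma clique_number_iso_hstar:
  assumes "finite (pverts G)" and "graph_iso G (complement hstar)"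
  shows "card (pverts G) = 16" "clique_number G \<le> 5"
proof -
  obtain f where bij: "bij_betw f (pverts G) (pverts (complement hstar))"
    and arcs: "\<And>u v. u \<in> pverts G \<Longrightarrow> v \<in> pverts G \<Longrightarrow>
      (f u, f v) \<in> parcs (complement hstar) \<longleftrightarrow> (u, v) \<in> parcs G"
    by (rule graph_isoD[OF assms(2)]) blast
  show "card (pverts G) = 16"
    using bij_betw_same_card[OF bij] by (simp add: complement_def hstar_def graph_of_def card_hstar_vertex)
  obtain S where S: "clique G S" "card S = clique_number G"
    by (rule clique_number_attained[OF assms(1)])
  have sub: "S \<subseteq> pverts G" using S(1) by (simp add: clique_def)
  have loop: "(a, a) \<notin> parcs hstar" for a
    by (cases a) (simp_all add: parcs_hstar)
  have "(f x, f y) \<notin> parcs hstar" if "x \<in> S" "y \<in> S" for x y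
  proof (cases "x = y")
    case False
    then have "(x, y) \<in> parcs G" using S(1) that by (auto simp: clique_def)
    then have "(f x, f y) \<in> parcs (complement hstar)" using arcs that sub by blast
    then show ?thesis by (simp add: complement_def)
  qed (simp add: loop)
  then have "card (f ` S) \<le> 5"
    by (intro hstar_independent_le_5) blast
  moreover have "inj_on f S"
    using bij sub by (auto simp: bij_betw_def intro: inj_on_subset)
  ultimately show "clique_number G \<le> 5"
    using S(2) by (simp add: card_image)
qed

theorem theorem1p9:
  fixes G :: "'a pair_pre_digraph" and n :: nat
  assumes "pair_graph G"
    and "card (pverts G) = n"
    and "graph_free {three_K1, paraglider} G"
  shows "real (clique_number G) \<ge> (real n - 1) / 3 \<and>
    (real (clique_number G) = (real n - 1) / 3 \<longleftrightarrow> graph_iso G (complement hstar))"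
proof -
  note extremal = extremal_iso[OF assms(1,3)]
  \<comment> \<open>\<open>extremal\<close> turns \<open>3 * clique_number G + 1\<close> \<le>
    \<open>n\<close> into an equality, so \<open>n\<close> cannot be larger.\<close>
  have le: "n \<le> 3 * clique_number G + 1"
    using extremal assms(2) by linarith
  have fin: "finite (pverts G)"
    using assms(1) by (simp add: pair_graph_def pair_digraph_def pair_fin_digraph.pair_finite_verts)
  have "n = 3 * clique_number G + 1 \<longleftrightarrow> graph_iso G (complement hstar)"
  proof
    assume "n = 3 * clique_number G + 1"
    then show "graph_iso G (complement hstar)"
      using extremal assms(2) by simp
  next
    assume "graph_iso G (complement hstar)"
    then show "n = 3 * clique_number G + 1"
      using clique_number_iso_hstar[OF fin] assms(2) le by simp
  qed
  moreover have "real (clique_number G) = (real n - 1) / 3 \<longleftrightarrow> real n = real (3 * clique_number G + 1)"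
    by auto
  moreover have "(real n - 1) / 3 \<le> real (clique_number G)"
    using of_nat_mono[OF le, where 'a = real] by simp
  ultimately show ?thesis
    unfolding of_nat_eq_iff by blast
qed

end
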